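(* Let $G=\mathrm{GIRG}(n,\beta,w_0,d)$ be a standard GIRG and let $k\ge 3$ be a constant. Let $U_k=\{v_1,\dots,v_k\}$ be a set of $k$ vertices chosen uniformly at random, with weights $w_1,\dots,w_k$, let $\kappa_{ij}=\min\{\lambda w_iw_j,n\}$ and $\{\kappa\}^{(k)}=\{\kappa_{ij}\mid 1\le i<j\le k\}$, and let $E(U_k)$ denote the (random) set of edges of $G$ among the vertices of $U_k$. Then, if $d=\omega(\log^2 n)$, for every set of edges $\mathcal{A}\subseteq\binom{U_k}{2}$, $$\Pr\Big[E(U_k)\supseteq\mathcal{A}\ \Big|\ \{\kappa\}^{(k)}\Big]=(1\pm o(1))\prod_{\{i,j\}\in\mathcal{A}}\frac{\kappa_{ij}}{n}.$$ If $d=\omega(\log n)$, then for every $\mathcal{A}\subseteq\binom{U_k}{2}$, $$\Pr\Big[E(U_k)\supseteq\mathcal{A}\ \Big|\ \{\kappa\}^{(k)}\Big]=(1\pm o(1))\prod_{\{i,j\}\in\mathcal{A}}\Big(\frac{\kappa_{ij}}{n}\Big)^{1\mp O\left(\frac{\log n}{d}\right)}.$$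
   Context: Fix constants $\lambda>0$, $w_0>0$, $\beta>2$. A standard GIRG $\mathrm{GIRG}(n,\beta,w_0,d)$ has $n$ vertices; each vertex $v$ independently receives a weight $w_v$ with $\Pr[w_v\le x]=1-(x/w_0)^{1-\beta}$ for $x\ge w_0$, and independently a position $\mathbf{x}_v$ uniform on the torus $\mathbb{T}^d=[0,1)^d$. The distance is $d(\mathbf{x}_u,\mathbf{x}_v)=\max_{1\le i\le d}|x_{ui}-x_{vi}|_C$ with $|a-b|_C=\min\{|a-b|,1-|a-b|\}$. Distinct $u,v$ are adjacent iff $d(\mathbf{x}_u,\mathbf{x}_v)\le t_{uv}=\big(\frac{w_uw_v}{\tau n}\big)^{1/d}=\frac12\big(\frac{\lambda w_uw_v}{n}\big)^{1/d}$, where $\tau=2^d/\lambda$. The dimension $d=d(n)$ may depend on $n$; all asymptotics are as $n\to\infty$. The first display means the ratio of the two sides tends to $1$; the second means that there is a constant $C>0$ such that the probability lies between $(1-o(1))\prod(\kappa_{ij}/n)^{1+C\log n/d}$ and $(1+o(1))\prod(\kappa_{ij}/n)^{1-C\log n/d}$. *)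

theory Defs
  imports "HOL-Probability.Probability" "HOL-Library.Landau_Symbols"
begin

definition weight_cdf :: "real \<Rightarrow> real \<Rightarrow> real \<Rightarrow> real" where
  "weight_cdf \<beta> w0 x = (if x < w0 then 0 else 1 - (x / w0) powr (1 - \<beta>))"

definition weight_dist :: "real \<Rightarrow> real \<Rightarrow> real measure" where
  "weight_dist \<beta> w0 = interval_measure (weight_cdf \<beta> w0)"

definition torus_dist_measure :: "nat \<Rightarrow> (nat \<Rightarrow> real) measure" where
  "torus_dist_measure d = (\<Pi>\<^sub>M i\<in>{1..d}. uniform_measure lborel {0..<1})"

definition circ_dist :: "real \<Rightarrow> real \<Rightarrow> real" where
  "circ_dist a b = min \<bar>a - b\<bar> (1 - \<bar>a - b\<bar>)"

definition torus_dist :: "nat \<Rightarrow> (nat \<Rightarrow> real) \<Rightarrow> (nat \<Rightarrow> real) \<Rightarrow> real" where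
  "torus_dist d x y = (MAX i\<in>{1..d}. circ_dist (x i) (y i))"

text \<open>An outcome of the model on the vertex set \<open>{1..n}\<close> is a pair \<open>(w, x)\<close> with \<open>w v\<close> the
  weight and \<open>x v\<close> the position of vertex \<open>v\<close>.  The product measure makes all weights and
  positions independent.\<close>

type_synonym girg_outcome = "(nat \<Rightarrow> real) \<times> (nat \<Rightarrow> nat \<Rightarrow> real)"

definition girg :: "nat \<Rightarrow> real \<Rightarrow> real \<Rightarrow> nat \<Rightarrow> girg_outcome measure" where
  "girg n \<beta> w0 d =
     (\<Pi>\<^sub>M v\<in>{1..n}. weight_dist \<beta> w0) \<Otimes>\<^sub>M (\<Pi>\<^sub>M v\<in>{1..n}. torus_dist_measure d)"

definition conn_threshold :: "real \<Rightarrow> nat \<Rightarrow> nat \<Rightarrow> real \<Rightarrow> real \<Rightarrow> real" where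
  "conn_threshold lam n d a b = (let \<tau> = 2 ^ d / lam in (a * b / (\<tau> * real n)) powr (1 / real d))"

definition girg_edges :: "real \<Rightarrow> nat \<Rightarrow> nat \<Rightarrow> girg_outcome \<Rightarrow> nat set set" where
  "girg_edges lam n d = (\<lambda>(w, x). {{u, v} | u v. u \<in> {1..n} \<and> v \<in> {1..n} \<and> u \<noteq> v \<and>
     torus_dist d (x u) (x v) \<le> conn_threshold lam n d (w u) (w v)})"

definition edges_among :: "nat set set \<Rightarrow> nat set \<Rightarrow> nat set set" where
  "edges_among E U = {e \<in> E. e \<subseteq> U}"

text \<open>The graph together with an independent uniformly random \<open>k\<close>-set \<open>U\<close> of its vertices.\<close>

definition sampled_girg ::
    "nat \<Rightarrow> real \<Rightarrow> real \<Rightarrow> nat \<Rightarrow> nat \<Rightarrow> (girg_outcome \<times> nat set) measure" where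
  "sampled_girg n \<beta> w0 d k =
     girg n \<beta> w0 d \<Otimes>\<^sub>M uniform_count_measure {U. U \<subseteq> {1..n} \<and> card U = k}"

text \<open>A labelling assigns to every \<open>k\<close>-set \<open>U\<close> an enumeration \<open>lab U 1, \<dots>, lab U k\<close> of its
  elements, which plays the role of \<open>v\<^sub>1, \<dots>, v\<^sub>k\<close>.\<close>

definition labelling :: "nat \<Rightarrow> (nat set \<Rightarrow> nat \<Rightarrow> nat) \<Rightarrow> bool" where
  "labelling k lab \<longleftrightarrow> (\<forall>U. finite U \<and> card U = k \<longrightarrow> bij_betw (lab U) {1..k} U)"

text \<open>The two-element subsets \<open>{i, j}\<close> of \<open>{1..k}\<close> are represented by the pairs \<open>(i, j)\<close>
  with \<open>i < j\<close>.\<close>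

definition label_pairs :: "nat \<Rightarrow> (nat \<times> nat) set" where
  "label_pairs k = {(i, j). 1 \<le> i \<and> i < j \<and> j \<le> k}"

definition kappa ::
    "real \<Rightarrow> nat \<Rightarrow> (nat set \<Rightarrow> nat \<Rightarrow> nat) \<Rightarrow> nat \<times> nat \<Rightarrow> girg_outcome \<times> nat set \<Rightarrow> real" where
  "kappa lam n lab = (\<lambda>(i, j) ((w, x), U). min (lam * w (lab U i) * w (lab U j)) (real n))"

definition kappa_algebra ::
    "nat \<Rightarrow> real \<Rightarrow> real \<Rightarrow> nat \<Rightarrow> nat \<Rightarrow> real \<Rightarrow> (nat set \<Rightarrow> nat \<Rightarrow> nat)
      \<Rightarrow> (girg_outcome \<times> nat set) measure" where
  "kappa_algebra n \<beta> w0 d k lam lab =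
     vimage_algebra (space (sampled_girg n \<beta> w0 d k))
       (\<lambda>\<omega>. \<lambda>p\<in>label_pairs k. kappa lam n lab p \<omega>) (\<Pi>\<^sub>M p\<in>label_pairs k. borel)"

definition contains_event ::
    "nat \<Rightarrow> real \<Rightarrow> real \<Rightarrow> nat \<Rightarrow> nat \<Rightarrow> real \<Rightarrow> (nat set \<Rightarrow> nat \<Rightarrow> nat) \<Rightarrow> (nat \<times> nat) set
      \<Rightarrow> (girg_outcome \<times> nat set) set" where
  "contains_event n \<beta> w0 d k lam lab A =
     {(g, U) \<in> space (sampled_girg n \<beta> w0 d k).
        edges_among (girg_edges lam n d g) U \<supseteq> (\<lambda>(i, j). {lab U i, lab U j}) ` A}"

text \<open>The probability that \<open>E(U)\<close> contains \<open>A\<close> conditional on the family of all \<open>\<kappa>\<^sub>i\<^sub>j\<close>: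
  a random variable, determined up to null sets.\<close>

definition contains_cond_prob ::
    "nat \<Rightarrow> real \<Rightarrow> real \<Rightarrow> nat \<Rightarrow> nat \<Rightarrow> real \<Rightarrow> (nat set \<Rightarrow> nat \<Rightarrow> nat) \<Rightarrow> (nat \<times> nat) set
      \<Rightarrow> girg_outcome \<times> nat set \<Rightarrow> real" where
  "contains_cond_prob n \<beta> w0 d k lam lab A =
     real_cond_exp (sampled_girg n \<beta> w0 d k) (kappa_algebra n \<beta> w0 d k lam lab)
       (indicator (contains_event n \<beta> w0 d k lam lab A))"

lemma
  assumes "w0 > 0" "\<beta> > 1"
  shows real_distribution_weight_dist: "real_distribution (weight_dist \<beta> w0)"
    and cdf_weight_dist: "cdf (weight_dist \<beta> w0) = weight_cdf \<beta> w0"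
proof -
  let ?F = "weight_cdf \<beta> w0"
  have mono: "?F x \<le> ?F y" if "x \<le> y" for x y
  proof -
    consider "y < w0" | "x < w0" "w0 \<le> y" | "w0 \<le> x" by linarith
    then show ?thesis
    proof cases
      case 1
      then show ?thesis using that by (simp add: weight_cdf_def)
    next
      case 2
      have "(y / w0) powr (1 - \<beta>) \<le> (y / w0) powr 0"
        using 2 assms by (intro powr_mono) auto
      then show ?thesis using 2 assms by (simp add: weight_cdf_def split: if_splits)
    next
      case 3
      have "(y / w0) powr (1 - \<beta>) \<le> (x / w0) powr (1 - \<beta>)"
        using 3 that assms by (intro powr_mono2') (auto simp: divide_right_mono)
      then show ?thesis using 3 that by (simp add: weight_cdf_def)
    qed
  qed
  have cont: "continuous (at_right a) ?F" for a
  proof (cases "a < w0")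
    case True
    have "eventually (\<lambda>x. ?F x = 0) (at_right a)"
      unfolding eventually_at_right_field using True
      by (intro exI[of _ w0]) (auto simp: weight_cdf_def)
    then show ?thesis
      using True by (simp add: continuous_within weight_cdf_def tendsto_eventually)
  next
    case False
    have "((\<lambda>x. 1 - (x / w0) powr (1 - \<beta>)) \<longlongrightarrow> ?F a) (at_right a)"
      using False assms by (auto simp: weight_cdf_def intro!: tendsto_eq_intros)
    moreover have "eventually (\<lambda>x. 1 - (x / w0) powr (1 - \<beta>) = ?F x) (at_right a)"
      unfolding eventually_at_right_field using False
      by (intro exI[of _ "a + 1"]) (auto simp: weight_cdf_def)
    ultimately show ?thesis
      unfolding continuous_within by (rule Lim_transform_eventually)
  qed
  have bot: "(?F \<longlongrightarrow> 0) at_bot"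
  proof (rule tendsto_eventually)
    show "eventually (\<lambda>x. ?F x = 0) at_bot"
      using eventually_gt_at_bot[of w0] eventually_at_bot_dense
      by (auto simp: weight_cdf_def eventually_at_bot_dense)
  qed
  have top: "(?F \<longlongrightarrow> 1) at_top"
  proof -
    have lim: "filterlim (\<lambda>x. x / w0) at_top at_top"
      using filterlim_tendsto_pos_mult_at_top[of "\<lambda>_. inverse w0" "inverse w0" at_top "\<lambda>x. x"]
        assms by (simp add: filterlim_ident field_simps)
    have "((\<lambda>x. 1 - (x / w0) powr (1 - \<beta>)) \<longlongrightarrow> 1 - 0) at_top"
      using assms by (intro tendsto_diff tendsto_const tendsto_neg_powr lim) auto
    moreover have "eventually (\<lambda>x. 1 - (x / w0) powr (1 - \<beta>) = ?F x) at_top"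
      using eventually_ge_at_top[of w0] by eventually_elim (auto simp: weight_cdf_def)
    ultimately show ?thesis
      using Lim_transform_eventually by fastforce
  qed
  show "real_distribution (weight_dist \<beta> w0)"
    unfolding weight_dist_def by (rule real_distribution_interval_measure[OF mono cont bot top])
  show "cdf (weight_dist \<beta> w0) = ?F"
    unfolding weight_dist_def by (rule cdf_interval_measure[OF mono cont bot])
qed

end

theory Submission
  imports Defs
begin

text \<open>
  Put \<open>r\<^sub>p = (\<kappa>\<^sub>p / n) powr (1/d)\<close>.  Since \<open>circ_dist\<close> never exceeds \<open>1/2\<close>, an edge \<open>p\<close> is present iff in
  every one of the \<open>d\<close> coordinates its endpoints are at circular distance at most \<open>r\<^sub>p / 2\<close>.  The
  coordinates are independent, so given the weights the edges of \<open>A\<close> are all present with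
  probability \<open>P ^ d\<close>, where \<open>P\<close> is the corresponding probability for one uniform point per vertex on a
  circle.  This depends on the weights only through the \<open>\<kappa>\<^sub>p\<close>, so it is the conditional probability.

  On the circle the events that \<open>p\<close> is violated have probability \<open>1 - r\<^sub>p\<close> and are pairwise independent.
  The first two Bonferroni inequalities thus give \<open>1 - S \<le> P \<le> 1 - S + S\<^sup>2/2\<close> with
  \<open>S = (\<Sum>p\<in>A. 1 - r\<^sub>p) = O(log n / d)\<close>, and therefore \<open>ln P = (1 \<plusminus> O(log n / d)) * (\<Sum>p\<in>A. ln r\<^sub>p)\<close>.
  Taking \<open>d\<close>-th powers gives the second claim, even with \<open>\<epsilon> = 0\<close>.  The correction to the exponent costs a
  factor \<open>exp (O((log n)\<^sup>2 / d))\<close>, which is \<open>1 + o(1)\<close> under the hypothesis of the first claim.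
\<close>

section \<open>Independence of the coordinates of iterated product measures\<close>

lemma measurable_PiM_PiM_component:
  assumes "i \<in> I" "j \<in> J"
  shows "(\<lambda>x. x i j) \<in> PiM I (\<lambda>_. PiM J (\<lambda>_. \<mu>)) \<rightarrow>\<^sub>M \<mu>"
  by (rule measurable_compose[of "\<lambda>x. x i" _ "PiM J (\<lambda>_. \<mu>)"]) (use assms in auto)

text \<open>The preimage of a rectangle under uncurrying is a rectangle of rectangles, so both
  measures give it the product of its side measures, and rectangles determine a product measure.
  This is the joint law of all entries \<open>x i j\<close>.\<close>

lemma distr_PiM_PiM_uncurry:
  assumes "finite I" "finite J" "prob_space \<mu>"
  shows "distr (PiM I (\<lambda>_. PiM J (\<lambda>_. \<mu>))) (PiM (I \<times> J) (\<lambda>_. \<mu>)) (\<lambda>x. \<lambda>p\<in>I \<times> J. x (fst p) (snd p))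
    = PiM (I \<times> J) (\<lambda>_. \<mu>)"
proof -
  interpret mu: prob_space \<mu> by fact
  interpret product_sigma_finite "\<lambda>_. \<mu>" by standard
  interpret PJ: prob_space "PiM J (\<lambda>_. \<mu>)" by (intro prob_space_PiM assms)
  interpret II: product_sigma_finite "\<lambda>_. PiM J (\<lambda>_. \<mu>)" by standard
  have meas: "(\<lambda>x. \<lambda>p\<in>I \<times> J. x (fst p) (snd p))
      \<in> PiM I (\<lambda>_. PiM J (\<lambda>_. \<mu>)) \<rightarrow>\<^sub>M PiM (I \<times> J) (\<lambda>_. \<mu>)"
    by (intro measurable_restrict measurable_PiM_PiM_component) auto
  show ?thesis
  proof (rule PiM_eqI)
    fix A :: "'a \<times> 'b \<Rightarrow> 'c set"
    assume A: "\<And>i. i \<in> I \<times> J \<Longrightarrow> A i \<in> sets \<mu>"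
    have "(\<lambda>x. \<lambda>p\<in>I \<times> J. x (fst p) (snd p)) -` Pi\<^sub>E (I \<times> J) A \<inter> space (PiM I (\<lambda>_. PiM J (\<lambda>_. \<mu>)))
      = (\<Pi>\<^sub>E i\<in>I. \<Pi>\<^sub>E j\<in>J. A (i, j))"
      using A[THEN sets.sets_into_space]
      by (auto simp: space_PiM PiE_iff extensional_def subset_eq split: prod.splits)
    then show "emeasure (distr (PiM I (\<lambda>_. PiM J (\<lambda>_. \<mu>))) (PiM (I \<times> J) (\<lambda>_. \<mu>))
        (\<lambda>x. \<lambda>p\<in>I \<times> J. x (fst p) (snd p))) (Pi\<^sub>E (I \<times> J) A) = (\<Prod>i\<in>I \<times> J. emeasure \<mu> (A i))"
      using assms A meas
      by (subst emeasure_distr) (auto simp: II.emeasure_PiM emeasure_PiM prod.cartesian_product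
          intro!: sets_PiM_I_finite)
  qed (use assms in auto)
qed

lemma distr_PiM_PiM_component:
  assumes "finite I" "finite J" "prob_space \<mu>" "j \<in> J"
  shows "distr (PiM I (\<lambda>_. PiM J (\<lambda>_. \<mu>))) (PiM I (\<lambda>_. \<mu>)) (\<lambda>x. \<lambda>i\<in>I. x i j) = PiM I (\<lambda>_. \<mu>)"
proof -
  interpret mu: prob_space \<mu> by fact
  interpret product_sigma_finite "\<lambda>_. \<mu>" by standard
  interpret PP: product_prob_space "\<lambda>_. \<mu>" J by standard
  interpret PJ: prob_space "PiM J (\<lambda>_. \<mu>)" by (intro prob_space_PiM assms)
  interpret II: product_sigma_finite "\<lambda>_. PiM J (\<lambda>_. \<mu>)" by standard
  have meas: "(\<lambda>x. \<lambda>i\<in>I. x i j) \<in> PiM I (\<lambda>_. PiM J (\<lambda>_. \<mu>)) \<rightarrow>\<^sub>M PiM I (\<lambda>_. \<mu>)"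
    using assms by (intro measurable_restrict measurable_PiM_PiM_component) auto
  show ?thesis
  proof (rule PiM_eqI)
    fix A :: "'a \<Rightarrow> 'c set"
    assume A: "\<And>i. i \<in> I \<Longrightarrow> A i \<in> sets \<mu>"
    have single: "{y \<in> space (PiM J (\<lambda>_. \<mu>)). y j \<in> A i} \<in> sets (PiM J (\<lambda>_. \<mu>))" if "i \<in> I" for i
      using A[OF that] assms by measurable
    have "(\<lambda>x. \<lambda>i\<in>I. x i j) -` Pi\<^sub>E I A \<inter> space (PiM I (\<lambda>_. PiM J (\<lambda>_. \<mu>)))
      = (\<Pi>\<^sub>E i\<in>I. {y \<in> space (PiM J (\<lambda>_. \<mu>)). y j \<in> A i})"
      by (auto simp: space_PiM PiE_iff extensional_def)
    then show "emeasure (distr (PiM I (\<lambda>_. PiM J (\<lambda>_. \<mu>))) (PiM I (\<lambda>_. \<mu>))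
        (\<lambda>x. \<lambda>i\<in>I. x i j)) (Pi\<^sub>E I A) = (\<Prod>i\<in>I. emeasure \<mu> (A i))"
      using assms A meas single
      by (subst emeasure_distr) (auto simp: II.emeasure_PiM PP.emeasure_PiM_Collect_single
          intro!: sets_PiM_I_finite prod.cong)
  qed (use assms in auto)
qed

text \<open>The entries \<open>x i j\<close> are mutually independent, so grouping them by
  \<open>j\<close> yields independent copies of a point of \<open>PiM I\<close>. With
  \<open>J\<close> the set of torus coordinates, this is the source of the \<open>d\<close>-th
  power.\<close>

lemma measure_PiM_PiM_all_components:
  assumes "finite I" "I \<noteq> {}" "finite J" "J \<noteq> {}" and mu: "prob_space \<mu>"
    and S: "S \<in> sets (PiM I (\<lambda>_. \<mu>))"
  shows "measure (PiM I (\<lambda>_. PiM J (\<lambda>_. \<mu>)))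
           {x \<in> space (PiM I (\<lambda>_. PiM J (\<lambda>_. \<mu>))). \<forall>j\<in>J. (\<lambda>i\<in>I. x i j) \<in> S}
         = measure (PiM I (\<lambda>_. \<mu>)) S ^ card J"
proof -
  let ?M = "PiM I (\<lambda>_. PiM J (\<lambda>_. \<mu>))"
  interpret M: prob_space ?M by (intro prob_space_PiM mu)
  have comp: "(\<lambda>x. x (fst p) (snd p)) \<in> ?M \<rightarrow>\<^sub>M \<mu>" if "p \<in> I \<times> J" for p
    using that by (intro measurable_PiM_PiM_component) auto
  have "distr ?M \<mu> (\<lambda>x. x (fst p) (snd p)) = \<mu>" if "p \<in> I \<times> J" for p
  proof -
    have "distr ?M \<mu> (\<lambda>x. x (fst p) (snd p))
        = distr (distr ?M (PiM J (\<lambda>_. \<mu>)) (\<lambda>x. x (fst p))) \<mu> (\<lambda>y. y (snd p))"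
      using that by (subst distr_distr) (auto simp: comp_def)
    also have "\<dots> = \<mu>"
      using that mu prob_space_PiM[of J "\<lambda>_. \<mu>"]
      by (simp add: distr_PiM_component[of I "\<lambda>_. PiM J (\<lambda>_. \<mu>)"] distr_PiM_component[of J "\<lambda>_. \<mu>"]
          mem_Times_iff)
    finally show ?thesis .
  qed
  then have "(\<Pi>\<^sub>M p\<in>I \<times> J. distr ?M \<mu> (\<lambda>x. x (fst p) (snd p))) = PiM (I \<times> J) (\<lambda>_. \<mu>)"
    by (intro PiM_cong) auto
  \<comment> \<open>Independence is checked by comparing laws: the joint law of all entries is the
    product of the marginal laws.\<close>
  then have "M.indep_vars (\<lambda>_. \<mu>) (\<lambda>p x. x (fst p) (snd p)) (I \<times> J)"
    using assms comp
    by (subst M.indep_vars_iff_distr_eq_PiM') (auto simp: distr_PiM_PiM_uncurry)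
  \<comment> \<open>The blocks \<open>I \<times> {j}\<close> are disjoint, so the corresponding
    subfamilies are independent. The next fact only renames the index \<open>(i, j)\<close> to
    \<open>i\<close>.\<close>
  then have "M.indep_vars (\<lambda>j. PiM (I \<times> {j}) (\<lambda>_. \<mu>))
      (\<lambda>j x. \<lambda>p\<in>I \<times> {j}. x (fst p) (snd p)) J"
    by (rule M.indep_vars_restrict) (auto simp: disjoint_family_on_def)
  then have "M.indep_vars (\<lambda>_. PiM I (\<lambda>_. \<mu>))
      (\<lambda>j x. (\<lambda>z. \<lambda>i\<in>I. z (i, j)) (\<lambda>p\<in>I \<times> {j}. x (fst p) (snd p))) J"
    by (rule M.indep_vars_compose2) (intro measurable_restrict measurable_component_singleton, simp)
  then have ind: "M.indep_vars (\<lambda>_. PiM I (\<lambda>_. \<mu>)) (\<lambda>j x. \<lambda>i\<in>I. x i j) J"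
    by (simp cong: restrict_cong)
  have "M.prob {x \<in> space ?M. \<forall>j\<in>J. (\<lambda>i\<in>I. x i j) \<in> S}
      = M.prob (\<Inter>j\<in>J. (\<lambda>x. \<lambda>i\<in>I. x i j) -` S \<inter> space ?M)"
    using \<open>J \<noteq> {}\<close> by (intro arg_cong[where f=M.prob]) auto
  also have "\<dots> = (\<Prod>j\<in>J. M.prob ((\<lambda>x. \<lambda>i\<in>I. x i j) -` S \<inter> space ?M))"
    using assms by (intro M.indep_varsD_finite[OF ind]) auto
  also have "\<dots> = (\<Prod>j\<in>J. measure (PiM I (\<lambda>_. \<mu>)) S)"
  proof (intro prod.cong refl)
    fix j assume "j \<in> J"
    then have "measure (distr ?M (PiM I (\<lambda>_. \<mu>)) (\<lambda>x. \<lambda>i\<in>I. x i j)) S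
        = M.prob ((\<lambda>x. \<lambda>i\<in>I. x i j) -` S \<inter> space ?M)"
      using S by (intro measure_distr measurable_restrict measurable_PiM_PiM_component) auto
    then show "M.prob ((\<lambda>x. \<lambda>i\<in>I. x i j) -` S \<inter> space ?M) = measure (PiM I (\<lambda>_. \<mu>)) S"
      using assms \<open>j \<in> J\<close> by (simp add: distr_PiM_PiM_component)
  qed
  finally show ?thesis by simp
qed

section \<open>Random points on the circle\<close>

abbreviation unit_uniform :: "real measure" where
  "unit_uniform \<equiv> uniform_measure lborel {0..<1}"

lemma prob_space_unit_uniform: "prob_space unit_uniform"
  by (rule prob_space_uniform_measure) auto

lemma circ_dist_commute: "circ_dist a b = circ_dist b a"
  by (simp add: circ_dist_def abs_minus_commute)

lemma circ_dist_le_half: "circ_dist a b \<le> 1 / 2"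
  by (simp add: circ_dist_def min_def)

lemma measurable_circ_dist [measurable]:
  assumes [measurable]: "f \<in> borel_measurable M" "g \<in> borel_measurable M"
  shows "(\<lambda>x. circ_dist (f x) (g x)) \<in> borel_measurable M"
  unfolding circ_dist_def by measurable

text \<open>The points within distance \<open>t\<close> of \<open>y\<close> form an arc of length
  \<open>2 * t\<close>. That the answer does not depend on \<open>y\<close> is what later makes
  overlapping pairs independent.\<close>

lemma emeasure_circ_dist_gt:
  fixes y t :: real
  assumes y: "y \<in> {0..<1}" and t: "0 \<le> t" "t \<le> 1 / 2"
  shows "emeasure unit_uniform {x. t < circ_dist x y} = ennreal (1 - 2 * t)"
proof -
  have Ioo: "emeasure lborel {a<..<b} = ennreal (max 0 (b - a))" for a b :: real
    by (cases "a \<le> b") auto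
  \<comment> \<open>The far points form an arc opposite to \<open>y\<close>. Cutting the circle at 0
    leaves at most two open intervals, clipped by \<open>min\<close> and \<open>max\<close>; the cut
    point 0 lies in neither and is split off as a null set.\<close>
  have "{0..<1} \<inter> {x. t < circ_dist x y} =
      {y + t<..<min 1 (y + 1 - t)} \<union> {max 0 (y - 1 + t)<..<y - t} \<union> ({0} \<inter> {x. t < circ_dist x y})"
    using assms by (auto simp: circ_dist_def min_def max_def abs_if split: if_splits)
  moreover have "{0} \<inter> {x. t < circ_dist x y} \<in> null_sets lborel"
    by (cases "t < circ_dist 0 y") auto
  ultimately have "emeasure lborel ({0..<1} \<inter> {x. t < circ_dist x y}) =
      emeasure lborel ({y + t<..<min 1 (y + 1 - t)} \<union> {max 0 (y - 1 + t)<..<y - t})"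
    by (simp add: emeasure_Un_null_set)
  also have "\<dots> = emeasure lborel {y + t<..<min 1 (y + 1 - t)} + emeasure lborel {max 0 (y - 1 + t)<..<y - t}"
    using t by (intro plus_emeasure[symmetric]) auto
  also have "\<dots> = ennreal (max 0 (min 1 (y + 1 - t) - (y + t))) + ennreal (max 0 (y - t - max 0 (y - 1 + t)))"
    
    by (simp only: Ioo)
  also have "\<dots> = ennreal (1 - 2 * t)"
    using assms by (subst ennreal_plus[symmetric])
      (auto simp: min_def max_def simp del: ennreal_plus intro!: arg_cong[where f=ennreal])
  finally show ?thesis
    using t by (subst emeasure_uniform_measure) (auto simp: divide_ennreal simp flip: ennreal_1)
qed


text \<open>Resampling the point \<open>x i\<close> alone already randomises its distance to \<open>x j\<close> completely, whatever the
  other points are.  Two distinct pairs differ in some vertex, hence their distances are independent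
  even when the pairs overlap.\<close>

lemma measure_circ_dist_gt_conj:
  assumes I: "finite I" "i \<in> I" "j \<in> I" "i \<noteq> j" and t: "0 \<le> t" "t \<le> 1 / 2"
    and Q[measurable]: "Measurable.pred (PiM I (\<lambda>_. unit_uniform)) Q"
    and indep: "\<And>x y. Q (x(i := y)) = Q x"
  shows "measure (PiM I (\<lambda>_. unit_uniform))
           {x \<in> space (PiM I (\<lambda>_. unit_uniform)). t < circ_dist (x i) (x j) \<and> Q x}
         = (1 - 2 * t) * measure (PiM I (\<lambda>_. unit_uniform)) {x \<in> space (PiM I (\<lambda>_. unit_uniform)). Q x}"
proof -
  let ?P = "\<lambda>I. PiM I (\<lambda>_. unit_uniform)"
  interpret U: prob_space unit_uniform by (rule prob_space_unit_uniform)
  interpret product_sigma_finite "\<lambda>_. unit_uniform" by standard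
  interpret P: prob_space "?P I" by (intro prob_space_PiM prob_space_unit_uniform)
  define I' where "I' = I - {i}"
  have I': "I = insert i I'" "finite I'" "i \<notin> I'" "j \<in> I'" using I by (auto simp: I'_def)
  have [measurable]: "i \<in> I" "j \<in> I" by fact+
  have [measurable]: "(\<lambda>x. x(i := 0)) \<in> ?P I' \<rightarrow>\<^sub>M ?P I"
    unfolding I'(1) by (rule measurable_add_dim[THEN measurable_compose_rev, of "\<lambda>x. (x, 0)", unfolded split_beta fst_conv snd_conv]) auto
  have split: "(\<integral>\<^sup>+ x. f x \<partial>?P I) = (\<integral>\<^sup>+ x. \<integral>\<^sup>+ y. f (x(i := y)) \<partial>unit_uniform \<partial>?P I')"
    if "f \<in> borel_measurable (?P I)" for f
    using that I' by (simp add: product_nn_integral_insert)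
  \<comment> \<open>The underlying space of \<open>unit_uniform\<close> is the whole real line, so
    the hypothesis on \<open>y\<close> in \<open>emeasure_circ_dist_gt\<close> holds only almost
    everywhere.\<close>
  have unit: "AE x in ?P I'. x j \<in> {0..<1}"
    using I' by (intro AE_PiM_component prob_space_unit_uniform AE_uniform_measureI) auto
  have "emeasure (?P I) {x \<in> space (?P I). t < circ_dist (x i) (x j) \<and> Q x}
      = (\<integral>\<^sup>+ x. indicator {x. t < circ_dist (x i) (x j)} x * indicator {x. Q x} x \<partial>?P I)"
    by (subst nn_integral_indicator[symmetric], measurable, intro nn_integral_cong)
      (simp split: split_indicator)
  \<comment> \<open>By \<open>indep\<close> the resampled value \<open>y\<close> may be replaced by
    the fixed value 0 inside \<open>Q\<close>. That factor is then constant in \<open>y\<close> and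
    leaves the inner integral.\<close>
  also have "\<dots> = (\<integral>\<^sup>+ x. \<integral>\<^sup>+ y. indicator {y. t < circ_dist y (x j)} y * indicator {x. Q x} (x(i := 0))
      \<partial>unit_uniform \<partial>?P I')"
    using I' by (subst split, measurable, intro nn_integral_cong)
      (use I in \<open>simp add: indep split: split_indicator\<close>)
  also have "\<dots> = (\<integral>\<^sup>+ x. ennreal (1 - 2 * t) * indicator {x. Q x} (x(i := 0)) \<partial>?P I')"
  proof (rule nn_integral_cong_AE)
    show "AE x in ?P I'. (\<integral>\<^sup>+ y. indicator {y. t < circ_dist y (x j)} y * indicator {x. Q x} (x(i := 0)) \<partial>unit_uniform)
        = ennreal (1 - 2 * t) * indicator {x. Q x} (x(i := 0))"
      using unit by eventually_elim (use t in \<open>simp add: nn_integral_multc emeasure_circ_dist_gt del: emeasure_uniform_measure\<close>)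
  qed
  also have "\<dots> = ennreal (1 - 2 * t) * (\<integral>\<^sup>+ x. indicator {x. Q x} (x(i := 0)) \<partial>?P I')"
    by (rule nn_integral_cmult) measurable
  also have "(\<integral>\<^sup>+ x. indicator {x. Q x} (x(i := 0)) \<partial>?P I') = (\<integral>\<^sup>+ x. indicator {x. Q x} x \<partial>?P I)"
    by (subst split) (auto simp: indicator_def indep U.emeasure_space_1 simp del: nn_integral_indicator)
  also have "\<dots> = emeasure (?P I) {x \<in> space (?P I). Q x}"
    by (subst nn_integral_indicator[symmetric], measurable, intro nn_integral_cong)
      (simp split: split_indicator)
  finally show ?thesis
    using t by (simp add: measure_def enn2real_mult)
qed

section \<open>Bonferroni bounds under pairwise independence\<close>

lemma (in prob_space) prob_avoid_ge:
  assumes "finite A" "\<And>a. a \<in> A \<Longrightarrow> B a \<in> events"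
  shows "1 - (\<Sum>a\<in>A. prob (B a)) \<le> prob (space M - (\<Union>a\<in>A. B a))"
proof -
  have "prob (\<Union>a\<in>A. B a) \<le> (\<Sum>a\<in>A. prob (B a))"
    using assms by (intro finite_measure_subadditive_finite) auto
  then show ?thesis
    using assms by (subst prob_compl) auto
qed

text \<open>Let \<open>N\<close> count the events that occur. The indicator of \<open>N = 0\<close>
  is at most \<open>(N - 1) * (N - 2) / 2\<close>, whose expectation involves only the first two
  moments of \<open>N\<close>. Pairwise independence controls the second moment.\<close>

lemma (in prob_space) prob_avoid_le:
  assumes A: "finite A" and B[measurable]: "\<And>a. a \<in> A \<Longrightarrow> B a \<in> events"
    and indep: "\<And>a b. a \<in> A \<Longrightarrow> b \<in> A \<Longrightarrow> a \<noteq> b \<Longrightarrow> prob (B a \<inter> B b) = prob (B a) * prob (B b)"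
  shows "prob (space M - (\<Union>a\<in>A. B a)) \<le> 1 - (\<Sum>a\<in>A. prob (B a)) + (\<Sum>a\<in>A. prob (B a))\<^sup>2 / 2"
proof -
  let ?S = "\<Sum>a\<in>A. prob (B a)"
  define N :: "'a \<Rightarrow> real" where "N x = (\<Sum>a\<in>A. indicator (B a) x)" for x
  have N_sq: "(N x)\<^sup>2 = (\<Sum>a\<in>A. \<Sum>b\<in>A. indicator (B a \<inter> B b) x)" for x
    by (simp add: N_def power2_eq_square sum_product indicator_inter_arith)
  have int: "integrable M (indicator (B a) :: 'a \<Rightarrow> real)" "integrable M (indicator (B a \<inter> B b) :: 'a \<Rightarrow> real)"
    if "a \<in> A" "b \<in> A" for a b
    using that B by (auto simp: less_top[symmetric])
  have int_N: "integrable M N" "integrable M (\<lambda>x. (N x)\<^sup>2)"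
    unfolding N_sq unfolding N_def using int by (auto )
  have EN: "expectation N = ?S"
    unfolding N_def using int B by (subst Bochner_Integration.integral_sum) auto
  have "expectation (\<lambda>x. (N x)\<^sup>2) = (\<Sum>a\<in>A. \<Sum>b\<in>A. prob (B a \<inter> B b))"
  proof -
    have "expectation (\<lambda>x. (N x)\<^sup>2) = (\<Sum>a\<in>A. expectation (\<lambda>x. \<Sum>b\<in>A. indicator (B a \<inter> B b) x))"
      unfolding N_sq using int(2) by (intro Bochner_Integration.integral_sum) auto
    also have "\<dots> = (\<Sum>a\<in>A. \<Sum>b\<in>A. expectation (indicator (B a \<inter> B b)))"
      using int(2) by (intro sum.cong refl Bochner_Integration.integral_sum) auto
    finally show ?thesis using B by simp
  qed
  \<comment> \<open>Off the diagonal this is pairwise independence. On the diagonal the intersection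
    is \<open>B a\<close> itself, and adding the square of its probability only enlarges the
    bound.\<close>
  also have "\<dots> \<le> (\<Sum>a\<in>A. \<Sum>b\<in>A. prob (B a) * prob (B b) + (if a = b then prob (B a) else 0))"
    by (intro sum_mono) (auto simp: indep)
  also have "\<dots> = ?S\<^sup>2 + ?S"
    using A by (simp add: sum.distrib sum_product power2_eq_square)
  finally have EN2: "expectation (\<lambda>x. (N x)\<^sup>2) \<le> ?S\<^sup>2 + ?S" .
  have "indicator (space M - (\<Union>a\<in>A. B a)) x \<le> 1 - 3 / 2 * N x + (N x)\<^sup>2 / 2" for x
  proof -
    \<comment> \<open>Integrality of \<open>N x\<close> matters: \<open>(m - 1) * (m - 2)\<close> is
      negative for real \<open>m\<close> strictly between 1 and 2.\<close>
    have "N x = real (card {a \<in> A. x \<in> B a})"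
      using A by (simp add: N_def indicator_def sum.If_cases Int_def)
    then obtain m :: nat where m: "N x = real m" by blast
    show ?thesis
    proof (cases "x \<in> (\<Union>a\<in>A. B a)")
      case True
      have "m = 0 \<or> m = 1 \<or> 2 \<le> m" by auto
      then have "0 \<le> (real m - 1) * (real m - 2)" by auto
      then show ?thesis using True m by (simp add: power2_eq_square algebra_simps)
    next
      case False
      then have "N x = 0" unfolding N_def by (intro sum.neutral) auto
      then show ?thesis by (simp split: split_indicator)
    qed
  qed
  then have "expectation (indicator (space M - (\<Union>a\<in>A. B a))) \<le> expectation (\<lambda>x. 1 - 3 / 2 * N x + (N x)\<^sup>2 / 2)"
    using int_N A B by (intro integral_mono integrable_real_indicator sets.Diff sets.finite_UN)
      (auto simp: less_top[symmetric])
  also have "\<dots> = 1 - 3 / 2 * expectation N + expectation (\<lambda>x. (N x)\<^sup>2) / 2"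
    using int_N by (simp add: prob_space)
  also have "\<dots> \<le> 1 - ?S + ?S\<^sup>2 / 2"
    using EN EN2 by simp
  finally show ?thesis
    by (simp add: Int_absorb2)
qed

text \<open>The threshold is \<open>r p / 2\<close> so that, for \<open>r p\<close> between 0 and 1,
  a single constraint between two distinct points holds with probability exactly
  \<open>r p\<close>.\<close>

definition circle_prob :: "nat set \<Rightarrow> (nat \<times> nat) set \<Rightarrow> (nat \<times> nat \<Rightarrow> real) \<Rightarrow> real" where
  "circle_prob I A r = measure (PiM I (\<lambda>_. unit_uniform))
     {x \<in> space (PiM I (\<lambda>_. unit_uniform)). \<forall>p\<in>A. circ_dist (x (fst p)) (x (snd p)) \<le> r p / 2}"

lemma circle_prob_bounds:
  assumes I: "finite I" and A: "A \<subseteq> {(i, j). i \<in> I \<and> j \<in> I \<and> i < j}"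
    and r: "\<And>p. p \<in> A \<Longrightarrow> 0 \<le> r p \<and> r p \<le> 1"
  defines "S \<equiv> \<Sum>p\<in>A. 1 - r p"
  shows "1 - S \<le> circle_prob I A r" and "circle_prob I A r \<le> 1 - S + S\<^sup>2 / 2"
proof -
  let ?P = "PiM I (\<lambda>_. unit_uniform)"
  interpret prob_space ?P by (intro prob_space_PiM prob_space_unit_uniform)
  have fin: "finite A"
    by (rule finite_subset[of _ "I \<times> I"]) (use I A in auto)
  have mem: "fst p \<in> I" "snd p \<in> I" "fst p < snd p" if "p \<in> A" for p
    using that A by auto
  define B where "B p = {x \<in> space ?P. r p / 2 < circ_dist (x (fst p)) (x (snd p))}" for p
  have pred[measurable]: "Measurable.pred ?P (\<lambda>x. r p / 2 < circ_dist (x (fst p)) (x (snd p)))"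
    if "p \<in> A" for p
  proof -
    note [measurable] = mem[OF that]
    show ?thesis by measurable
  qed
  have B: "B p \<in> events" if "p \<in> A" for p
    unfolding B_def using that by measurable
  have prob_B: "prob (B p) = 1 - r p" if "p \<in> A" for p
    using measure_circ_dist_gt_conj[of I "fst p" "snd p" "r p / 2" "\<lambda>_. True"] I mem[OF that] r[OF that]
    by (simp add: B_def prob_space)
  have indep: "prob (B p \<inter> B q) = prob (B p) * prob (B q)" if "p \<in> A" "q \<in> A" "p \<noteq> q" for p q
  proof -
    have *: "B p \<inter> B q = {x \<in> space ?P. r p / 2 < circ_dist (x (fst p)) (x (snd p)) \<and>
        r q / 2 < circ_dist (x (fst q)) (x (snd q))}"
      by (auto simp: B_def)
    \<comment> \<open>The same event with the endpoints of \<open>p\<close> swapped, since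
      \<open>measure_circ_dist_gt_conj\<close> resamples the first point of the pair.\<close>
    have sw: "B p \<inter> B q = {x \<in> space ?P. r p / 2 < circ_dist (x (snd p)) (x (fst p)) \<and>
        r q / 2 < circ_dist (x (fst q)) (x (snd q))}"
      by (auto simp: B_def circ_dist_commute)
    \<comment> \<open>Pairs are ordered increasingly, so two different pairs cannot have the same
      endpoints. The endpoint of \<open>p\<close> missing from \<open>q\<close> is the one to
      resample.\<close>
    have "fst p \<notin> {fst q, snd q} \<or> snd p \<notin> {fst q, snd q}"
      using mem[OF that(1)] mem[OF that(2)] that(3) by (auto simp: prod_eq_iff)
    then show ?thesis
    proof
      assume "fst p \<notin> {fst q, snd q}"
      then show ?thesis
        unfolding * prob_B[OF that(1)]
        using measure_circ_dist_gt_conj[OF I mem(1,2)[OF that(1)] _ _ _ pred[OF that(2)], where t="r p / 2"]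
          mem(3)[OF that(1)] r[OF that(1)] by (auto simp: B_def)
    next
      assume "snd p \<notin> {fst q, snd q}"
      then show ?thesis
        unfolding sw prob_B[OF that(1)]
        using measure_circ_dist_gt_conj[OF I mem(2,1)[OF that(1)] _ _ _ pred[OF that(2)], where t="r p / 2"]
          mem(3)[OF that(1)] r[OF that(1)] by (auto simp: B_def)
    qed
  qed
  have circle: "circle_prob I A r = prob (space ?P - (\<Union>p\<in>A. B p))"
    unfolding circle_prob_def by (intro arg_cong[where f=prob]) (auto simp: B_def not_less)
  have S: "S = (\<Sum>p\<in>A. prob (B p))"
    unfolding S_def by (simp add: prob_B)
  show "1 - S \<le> circle_prob I A r"
    unfolding circle S using fin B by (rule prob_avoid_ge)
  show "circle_prob I A r \<le> 1 - S + S\<^sup>2 / 2"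
    unfolding circle S using fin B indep by (rule prob_avoid_le)
qed

text \<open>Both Bonferroni bounds agree with \<open>exp (- Y)\<close> to first order, because
  \<open>Y - Y * Y \<le> S\<close> and \<open>S \<le> Y\<close>. The remaining error in the exponent
  is at most \<open>2 * Y\<^sup>2\<close>, which relative to \<open>Y\<close> is
  \<open>2 * Y\<close> and hence at most \<delta>.\<close>

lemma exp_bounds_of_bonferroni:
  fixes y :: "'a \<Rightarrow> real"
  assumes A: "finite A" and y: "\<And>p. p \<in> A \<Longrightarrow> 0 \<le> y p"
    and Y: "Y = (\<Sum>p\<in>A. y p)" "Y \<le> 1 / 2" "2 * Y \<le> \<delta>"
    and S: "S = (\<Sum>p\<in>A. 1 - exp (- y p))" "1 - S \<le> P" "P \<le> 1 - S + S\<^sup>2 / 2"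
  shows "exp (- (1 + \<delta>) * Y) \<le> P" and "P \<le> exp (- (1 - \<delta>) * Y)"
proof -
  have Y0: "0 \<le> Y" unfolding Y using y by (rule sum_nonneg)
  have S0: "0 \<le> S" unfolding S using y by (intro sum_nonneg) auto
  have SY: "S \<le> Y"
    unfolding S Y
  proof (rule sum_mono)
    show "1 - exp (- y p) \<le> y p" for p
      using exp_ge_add_one_self[of "- y p"] by simp
  qed
  have yY: "y p \<le> Y" if "p \<in> A" for p
    unfolding Y using that A y by (intro member_le_sum) auto
  have "Y - Y * Y \<le> S"
  proof -
    have "y p - y p * Y \<le> 1 - exp (- y p)" if p: "p \<in> A" for p
    proof -
      have "exp (- y p) * (1 + y p) \<le> exp (- y p) * exp (y p)"
        by (intro mult_left_mono) auto
      then have "exp (- y p) * (1 + y p) \<le> 1" by (simp flip: exp_add)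
      \<comment> \<open>The product on the right equals 1 plus the cube of \<open>y p\<close>.
        Cancelling \<open>1 + y p\<close> gives a second-order upper bound for
        \<open>exp (- y p)\<close>.\<close>
      also have "\<dots> \<le> (1 - y p + y p * y p) * (1 + y p)"
        using y[OF p] by (simp add: algebra_simps)
      finally have "exp (- y p) \<le> 1 - y p + y p * y p"
        using y[OF p] by (simp add: mult_le_cancel_right)
      moreover have "y p * y p \<le> y p * Y"
        using y[OF p] yY[OF p] by (intro mult_left_mono)
      ultimately show ?thesis by simp
    qed
    then have "(\<Sum>p\<in>A. y p - y p * Y) \<le> S" unfolding S by (rule sum_mono)
    then show ?thesis by (simp add: sum_subtractf sum_distrib_right[symmetric] flip: Y(1))
  qed
  moreover have "S\<^sup>2 \<le> Y\<^sup>2" using S0 SY by (intro power_mono)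
  \<comment> \<open>Replacing \<open>S\<close> by \<open>Y\<close> costs \<open>Y * Y\<close> and
    the Bonferroni square costs half of that; the total factor 3/2 is rounded up to 2 to match the
    lower bound.\<close>
  ultimately have "P \<le> 1 + (- Y + 2 * (Y * Y))"
    using S(3) zero_le_square[of Y] unfolding power2_eq_square by linarith
  also have "\<dots> \<le> exp (- Y + 2 * (Y * Y))" by (rule exp_ge_add_one_self)
  also have "\<dots> \<le> exp (- (1 - \<delta>) * Y)"
    using mult_right_mono[OF Y(3) Y0] by (simp add: algebra_simps)
  finally show "P \<le> exp (- (1 - \<delta>) * Y)" .
  have "exp (- (1 + \<delta>) * Y) \<le> exp (- Y - 2 * Y\<^sup>2)"
    using mult_right_mono[OF Y(3) Y0] by (simp add: algebra_simps power2_eq_square)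
  \<comment> \<open>The inequality \<open>- Y - 2 * Y\<^sup>2 \<le> ln (1 - Y)\<close> is where
    \<open>Y \<le> 1 / 2\<close> enters.\<close>
  also have "\<dots> \<le> exp (ln (1 - Y))"
    unfolding exp_le_cancel_iff using Y0 Y(2) by (intro ln_one_minus_pos_lower_bound) auto
  also have "\<dots> = 1 - Y" using Y(2) by simp
  also have "\<dots> \<le> P" using SY S(2) by simp
  finally show "exp (- (1 + \<delta>) * Y) \<le> P" .
qed

section \<open>Reduction of the torus to the circle\<close>

lemma torus_dist_le_iff:
  assumes "d \<ge> 1"
  shows "torus_dist d x y \<le> t \<longleftrightarrow> (\<forall>c\<in>{1..d}. circ_dist (x c) (y c) \<le> t)"
  unfolding torus_dist_def using assms by (subst Max_le_iff) auto

lemma torus_dist_le_half: "d \<ge> 1 \<Longrightarrow> torus_dist d x y \<le> 1 / 2"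
  unfolding torus_dist_le_iff using circ_dist_le_half by blast

lemma torus_dist_commute: "torus_dist d x y = torus_dist d y x"
  by (simp add: torus_dist_def circ_dist_commute)

definition torus_prob :: "nat \<Rightarrow> nat set \<Rightarrow> (nat \<times> nat) set \<Rightarrow> (nat \<times> nat \<Rightarrow> real) \<Rightarrow> real" where
  "torus_prob d I A t = measure (PiM I (\<lambda>_. torus_dist_measure d))
     {x \<in> space (PiM I (\<lambda>_. torus_dist_measure d)). \<forall>p\<in>A. torus_dist d (x (fst p)) (x (snd p)) \<le> t p}"

text \<open>A maximum is bounded iff every coordinate is, and the quantifiers over edges and
  coordinates commute. The event thus asks for the same circle event in each of \<open>d\<close>
  independent coordinates.\<close>

lemma torus_prob_eq_circle_prob:
  assumes I: "finite I" "I \<noteq> {}" and A: "A \<subseteq> I \<times> I" and d: "d \<ge> 1"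
  shows "torus_prob d I A t = circle_prob I A (\<lambda>p. 2 * t p) ^ d"
proof -
  let ?S = "{z \<in> space (PiM I (\<lambda>_. unit_uniform)). \<forall>p\<in>A. circ_dist (z (fst p)) (z (snd p)) \<le> t p}"
  have fin: "finite A" using I A finite_subset by blast
  have "?S \<in> sets (PiM I (\<lambda>_. unit_uniform))"
  proof (rule sets.sets_Collect_finite_All)
    fix p assume "p \<in> A"
    then have [measurable]: "fst p \<in> I" "snd p \<in> I" using A by auto
    show "{z \<in> space (PiM I (\<lambda>_. unit_uniform)). circ_dist (z (fst p)) (z (snd p)) \<le> t p}
        \<in> sets (PiM I (\<lambda>_. unit_uniform))"
      by measurable
  qed (use fin in auto)
  moreover have "{x \<in> space (PiM I (\<lambda>_. torus_dist_measure d)). \<forall>p\<in>A. torus_dist d (x (fst p)) (x (snd p)) \<le> t p}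
      = {x \<in> space (PiM I (\<lambda>_. torus_dist_measure d)). \<forall>c\<in>{1..d}. (\<lambda>i\<in>I. x i c) \<in> ?S}"
  proof (intro Collect_cong conj_cong refl)
    fix x assume x: "x \<in> space (PiM I (\<lambda>_. torus_dist_measure d))"
    have "(\<lambda>i\<in>I. x i c) \<in> ?S \<longleftrightarrow> (\<forall>p\<in>A. circ_dist (x (fst p) c) (x (snd p) c) \<le> t p)" for c
      using A by (fastforce simp: space_PiM)
    then show "(\<forall>p\<in>A. torus_dist d (x (fst p)) (x (snd p)) \<le> t p) \<longleftrightarrow> (\<forall>c\<in>{1..d}. (\<lambda>i\<in>I. x i c) \<in> ?S)"
      unfolding torus_dist_le_iff[OF d] by blast
  qed
  ultimately show ?thesis
    unfolding torus_prob_def circle_prob_def torus_dist_measure_def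
    using measure_PiM_PiM_all_components[OF I, of "{1..d}" unit_uniform ?S] d prob_space_unit_uniform
    by simp
qed

text \<open>The \<open>d\<close>-th root turns the factor \<open>2 ^ d\<close> of \<tau> into 2. If
  the weight product exceeds \<open>n\<close>, both thresholds are at least 1/2 and every such
  \<open>c\<close> passes. Hence edges see the weights only through the truncated products.\<close>

lemma le_conn_threshold_iff:
  assumes "lam > 0" "a > 0" "b > 0" "n \<ge> 1" "d \<ge> 1" "c \<le> 1 / 2"
  shows "c \<le> conn_threshold lam n d a b \<longleftrightarrow> c \<le> (min (lam * a * b) (real n) / real n) powr (1 / real d) / 2"
proof -
  have "(2 ^ d) powr (1 / real d) = (2 :: real)"
    using assms by (simp add: powr_realpow[symmetric] powr_powr)
  then have conn: "conn_threshold lam n d a b = (lam * a * b / real n) powr (1 / real d) / 2"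
    using assms powr_divide[of "lam * a * b / real n" "2 ^ d" "1 / real d"]
    by (simp add: conn_threshold_def Let_def field_simps)
  show ?thesis
  proof (cases "lam * a * b \<le> real n")
    case False
    then have "1 \<le> (lam * a * b / real n) powr (1 / real d)"
      using assms by (intro ge_one_powr_ge_zero) (auto simp: field_simps)
    then show ?thesis
      using False assms by (simp add: conn)
  qed (simp add: conn)
qed

text \<open>An unordered edge may arise from either ordering of its endpoints; the symmetry of
  distance and threshold makes the two conditions equal.\<close>

lemma doubleton_in_edges_among:
  assumes "u \<in> U" "v \<in> U" "U \<subseteq> {1..n}" "u \<noteq> v"
  shows "{u, v} \<in> edges_among (girg_edges lam n d (w, x)) U
    \<longleftrightarrow> torus_dist d (x u) (x v) \<le> conn_threshold lam n d (w u) (w v)"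
proof -
  have "conn_threshold lam n d (w u) (w v) = conn_threshold lam n d (w v) (w u)"
    by (simp add: conn_threshold_def mult.commute)
  moreover have "u \<in> {1..n}" "v \<in> {1..n}" using assms by auto
  ultimately show ?thesis
    using assms torus_dist_commute[of d "x u" "x v"]
    unfolding edges_among_def girg_edges_def by (auto simp: doubleton_eq_iff simp del: atLeastAtMost_iff)
qed

text \<open>The distribution function is continuous at \<open>w0\<close> with value 0 there. Since
  the measure lives on all reals, this is also how positivity of the weights is obtained.\<close>

lemma AE_weight_dist_gt:
  assumes "w0 > 0" "\<beta> > 1"
  shows "AE x in weight_dist \<beta> w0. w0 < x"
proof -
  interpret real_distribution "weight_dist \<beta> w0" by (rule real_distribution_weight_dist[OF assms])
  have "measure (weight_dist \<beta> w0) {..w0} = 0"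
    using cdf_weight_dist[OF assms] assms by (simp add: cdf_def fun_eq_iff weight_cdf_def)
  then have "AE x in weight_dist \<beta> w0. x \<notin> {..w0}"
    by (intro AE_not_in) (auto simp: null_sets_def emeasure_eq_measure)
  then show ?thesis by (simp add: not_le)
qed

section \<open>The probability conditional on the weight products\<close>

locale sampled_girg_setup =
  fixes lam w0 \<beta> :: real and k n d :: nat and lab :: "nat set \<Rightarrow> nat \<Rightarrow> nat" and A :: "(nat \<times> nat) set"
  assumes lam: "lam > 0" and w0: "w0 > 0" and \<beta>: "\<beta> > 1" and k: "k \<ge> 1" and n: "n \<ge> k" and d: "d \<ge> 1"
    and lab: "labelling k lab" and A: "A \<subseteq> label_pairs k"
begin

abbreviation "W \<equiv> \<Pi>\<^sub>M v\<in>{1..n}. weight_dist \<beta> w0"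
abbreviation "X \<equiv> \<Pi>\<^sub>M v\<in>{1..n}. torus_dist_measure d"
abbreviation "ksets \<equiv> {U. U \<subseteq> {1..n} \<and> card U = k}"
abbreviation "V \<equiv> uniform_count_measure ksets"
abbreviation "M \<equiv> sampled_girg n \<beta> w0 d k"
abbreviation "F \<equiv> kappa_algebra n \<beta> w0 d k lam lab"
abbreviation "E \<equiv> contains_event n \<beta> w0 d k lam lab A"

text \<open>The map generating \<open>F\<close>, written so that its independence of the positions
  is visible.\<close>

definition kappas :: "(nat \<Rightarrow> real) \<Rightarrow> nat set \<Rightarrow> nat \<times> nat \<Rightarrow> real" where
  "kappas w U = (\<lambda>p\<in>label_pairs k. min (lam * w (lab U (fst p)) * w (lab U (snd p))) (real n))"

text \<open>The candidate conditional probability as a function of the conditioned values. Its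
  points are indexed by the labels \<open>{1..k}\<close>, so neither \<open>U\<close> nor the
  weights occur.\<close>

definition kappa_prob :: "(nat \<times> nat \<Rightarrow> real) \<Rightarrow> real" where
  "kappa_prob \<kappa> = torus_prob d {1..k} A (\<lambda>p. (\<kappa> p / real n) powr (1 / real d) / 2)"

lemma kappas_eq: "(\<lambda>p\<in>label_pairs k. kappa lam n lab p \<omega>) = kappas (fst (fst \<omega>)) (snd \<omega>)"
  by (auto simp: kappas_def kappa_def fun_eq_iff split: prod.splits)

lemma label_pairs_mem: "p \<in> label_pairs k \<Longrightarrow> fst p \<in> {1..k} \<and> snd p \<in> {1..k} \<and> fst p \<noteq> snd p"
  by (auto simp: label_pairs_def)

lemma finite_label_pairs: "finite (label_pairs k)"
  by (rule finite_subset[of _ "{1..k} \<times> {1..k}"]) (auto simp: label_pairs_def)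

lemma finite_A: "finite A"
  using A finite_label_pairs by (rule finite_subset)

lemma lab_bij: "U \<in> ksets \<Longrightarrow> bij_betw (lab U) {1..k} U"
  using lab finite_subset[of U "{1..n}"] by (auto simp: labelling_def)

lemma lab_mem: "U \<in> ksets \<Longrightarrow> i \<in> {1..k} \<Longrightarrow> lab U i \<in> U \<and> lab U i \<in> {1..n}"
  using bij_betwE[OF lab_bij[of U]] by blast

lemma finite_ksets: "finite ksets"
  by (rule finite_subset[of _ "Pow {1..n}"]) auto

lemma ksets_nonempty: "ksets \<noteq> {}"
  using n obtain_subset_with_card_n[of k "{1..n}"] by fastforce

lemma prob_space_torus: "prob_space (torus_dist_measure d)"
  unfolding torus_dist_measure_def by (intro prob_space_PiM prob_space_unit_uniform)

lemma prob_space_weight: "prob_space (weight_dist \<beta> w0)"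
  using real_distribution_weight_dist[OF w0 \<beta>] by (simp add: real_distribution_def)

sublocale W: prob_space W
  by (intro prob_space_PiM prob_space_weight)

sublocale X: prob_space X
  by (intro prob_space_PiM prob_space_torus)

sublocale V: prob_space V
  using finite_ksets ksets_nonempty by (rule prob_space_uniform_count_measure)

sublocale WX: pair_prob_space W X ..

sublocale WXV: pair_prob_space "W \<Otimes>\<^sub>M X" V ..

lemma M_eq: "M = (W \<Otimes>\<^sub>M X) \<Otimes>\<^sub>M V"
  by (simp add: sampled_girg_def girg_def)

sublocale M: prob_space M
  unfolding M_eq by (rule WXV.prob_space_axioms)

lemma space_M: "space M = (space W \<times> space X) \<times> ksets"
  by (simp add: M_eq space_pair_measure space_uniform_count_measure)

section \<open>Measurability in the sampled model\<close>

lemma measurable_torus_dist_le: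
  assumes "u \<in> I" "v \<in> I" and f: "f \<in> N \<rightarrow>\<^sub>M PiM I (\<lambda>_. torus_dist_measure d)"
    and g[measurable]: "g \<in> borel_measurable N"
  shows "Measurable.pred N (\<lambda>x. torus_dist d (f x u) (f x v) \<le> g x)"
proof -
  have [measurable]: "(\<lambda>x. f x i c) \<in> borel_measurable N" if "i \<in> I" "c \<in> {1..d}" for i c
  proof -
    have "(\<lambda>x. x i c) \<in> PiM I (\<lambda>_. torus_dist_measure d) \<rightarrow>\<^sub>M unit_uniform"
      unfolding torus_dist_measure_def using that by (rule measurable_PiM_PiM_component)
    from measurable_compose[OF f this] show ?thesis
      using measurable_cong_sets[of N N unit_uniform borel] by simp
  qed
  show ?thesis
    unfolding torus_dist_le_iff[OF d] using assms by measurable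
qed

lemma measurable_weight_component:
  "v \<in> {1..n} \<Longrightarrow> (\<lambda>w. w v) \<in> borel_measurable W"
  using measurable_component_singleton[of v "{1..n}" "\<lambda>_. weight_dist \<beta> w0"]
  by (simp add: weight_dist_def cong: measurable_cong_sets)

lemma measurable_from_M:
  assumes "\<And>U. U \<in> ksets \<Longrightarrow> (\<lambda>g. f g U) \<in> W \<Otimes>\<^sub>M X \<rightarrow>\<^sub>M N"
  shows "(\<lambda>\<omega>. f (fst \<omega>) (snd \<omega>)) \<in> M \<rightarrow>\<^sub>M N"
proof (rule measurable_compose_countable'[where f="\<lambda>U \<omega>. f (fst \<omega>) U" and g=snd])
  show "snd \<in> M \<rightarrow>\<^sub>M count_space ksets"
    unfolding M_eq by measurable
  show "(\<lambda>\<omega>. f (fst \<omega>) U) \<in> M \<rightarrow>\<^sub>M N" if "U \<in> ksets" for U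
    unfolding M_eq by (rule measurable_compose[OF measurable_fst assms[OF that]])
  show "countable ksets" using finite_ksets by (rule countable_finite)
qed

lemma measurable_kappas:
  assumes "U \<in> ksets"
  shows "(\<lambda>w. kappas w U) \<in> W \<rightarrow>\<^sub>M PiM (label_pairs k) (\<lambda>_. borel)"
  unfolding kappas_def
proof (rule measurable_restrict)
  fix p assume "p \<in> label_pairs k"
  then have [measurable]: "(\<lambda>w. w (lab U (fst p))) \<in> borel_measurable W"
      "(\<lambda>w. w (lab U (snd p))) \<in> borel_measurable W"
    using label_pairs_mem lab_mem[OF assms] measurable_weight_component by blast+
  show "(\<lambda>w. min (lam * w (lab U (fst p)) * w (lab U (snd p))) (real n)) \<in> borel_measurable W"
    by measurable
qed

lemma measurable_kappas_M:
  "(\<lambda>\<omega>. kappas (fst (fst \<omega>)) (snd \<omega>)) \<in> M \<rightarrow>\<^sub>M PiM (label_pairs k) (\<lambda>_. borel)"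
  by (rule measurable_from_M[of "\<lambda>g U. kappas (fst g) U"])
    (rule measurable_compose[OF measurable_fst measurable_kappas])

lemma subalgebra_F: "subalgebra M F"
  unfolding subalgebra_def kappa_algebra_def kappas_eq
  using sets_image_in_sets[OF refl measurable_kappas_M] by simp

sublocale F: finite_measure_subalgebra M F
  by standard (rule subalgebra_F)

lemma measurable_kappas_F:
  "(\<lambda>\<omega>. kappas (fst (fst \<omega>)) (snd \<omega>)) \<in> F \<rightarrow>\<^sub>M PiM (label_pairs k) (\<lambda>_. borel)"
  unfolding kappa_algebra_def kappas_eq
  by (intro measurable_vimage_algebra1 funcsetI measurable_space[OF measurable_kappas_M])

lemma measurable_kappa_prob [measurable]:
  "kappa_prob \<in> borel_measurable (PiM (label_pairs k) (\<lambda>_. borel))"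
proof -
  let ?X = "PiM {1..k} (\<lambda>_. torus_dist_measure d)"
  let ?L = "PiM (label_pairs k) (\<lambda>_. borel :: real measure)"
  interpret X': prob_space ?X by (intro prob_space_PiM prob_space_torus)
  let ?Q = "\<lambda>\<kappa> x. \<forall>p\<in>A. torus_dist d (x (fst p)) (x (snd p)) \<le> (\<kappa> p / real n) powr (1 / real d) / 2"
  have [measurable]: "Measurable.pred (?L \<Otimes>\<^sub>M ?X) (\<lambda>z. ?Q (fst z) (snd z))"
  proof (rule pred_intros_finite(3)[OF finite_A])
    fix p assume "p \<in> A"
    then have [measurable]: "p \<in> label_pairs k" and "fst p \<in> {1..k}" "snd p \<in> {1..k}"
      using A label_pairs_mem by blast+
    show "Measurable.pred (?L \<Otimes>\<^sub>M ?X) (\<lambda>z. torus_dist d (snd z (fst p)) (snd z (snd p))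
        \<le> (fst z p / real n) powr (1 / real d) / 2)"
    proof (rule measurable_torus_dist_le)
      show "fst p \<in> {1..k}" "snd p \<in> {1..k}" by fact+
      show "snd \<in> ?L \<Otimes>\<^sub>M ?X \<rightarrow>\<^sub>M ?X" by (rule measurable_snd)
    qed measurable
  qed
  have "(\<lambda>\<kappa>. \<integral>x. (if ?Q \<kappa> x then 1 else 0 :: real) \<partial>?X) \<in> borel_measurable ?L"
    by (rule X'.borel_measurable_lebesgue_integral) (unfold case_prod_beta, measurable)
  moreover have "(\<integral>x. (if ?Q \<kappa> x then 1 else 0) \<partial>?X) = kappa_prob \<kappa>" for \<kappa>
  proof -
    have "(\<integral>x. (if ?Q \<kappa> x then 1 else 0) \<partial>?X) = (\<integral>x. indicat_real {x. ?Q \<kappa> x} x \<partial>?X)"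
      by (simp add: indicator_def of_bool_def)
    then show ?thesis
      by (simp add: kappa_prob_def torus_prob_def Int_def conj_commute)
  qed
  ultimately show ?thesis by simp
qed

lemma kappa_prob_bounded: "0 \<le> kappa_prob \<kappa>" "kappa_prob \<kappa> \<le> 1"
proof -
  interpret X': prob_space "PiM {1..k} (\<lambda>_. torus_dist_measure d)" by (intro prob_space_PiM prob_space_torus)
  show "0 \<le> kappa_prob \<kappa>" unfolding kappa_prob_def torus_prob_def by (rule measure_nonneg)
  show "kappa_prob \<kappa> \<le> 1" unfolding kappa_prob_def torus_prob_def by (rule X'.prob_le_1)
qed

definition linked :: "(nat \<Rightarrow> real) \<Rightarrow> (nat \<Rightarrow> nat \<Rightarrow> real) \<Rightarrow> nat set \<Rightarrow> bool" where
  "linked w x U \<longleftrightarrow> (\<forall>p\<in>A. torus_dist d (x (lab U (fst p))) (x (lab U (snd p)))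
      \<le> conn_threshold lam n d (w (lab U (fst p))) (w (lab U (snd p))))"

lemma E_eq: "E = {\<omega> \<in> space M. linked (fst (fst \<omega>)) (snd (fst \<omega>)) (snd \<omega>)}"
proof -
  have key: "(\<lambda>(i, j). {lab U i, lab U j}) ` A \<subseteq> edges_among (girg_edges lam n d (w, x)) U \<longleftrightarrow> linked w x U"
    if U: "U \<in> ksets" for w x U
  proof -
    have "{lab U (fst p), lab U (snd p)} \<in> edges_among (girg_edges lam n d (w, x)) U
      \<longleftrightarrow> torus_dist d (x (lab U (fst p))) (x (lab U (snd p)))
      \<le> conn_threshold lam n d (w (lab U (fst p))) (w (lab U (snd p)))" if "p \<in> A" for p
    proof (rule doubleton_in_edges_among)
      have p: "fst p \<in> {1..k}" "snd p \<in> {1..k}" "fst p \<noteq> snd p"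
        using that A label_pairs_mem by blast+
      then show "lab U (fst p) \<in> U" "lab U (snd p) \<in> U" using lab_mem[OF U] by blast+
      show "lab U (fst p) \<noteq> lab U (snd p)"
        using lab_bij[OF U] p by (auto simp: bij_betw_def inj_on_eq_iff simp del: atLeastAtMost_iff)
    qed (use U in auto)
    then show ?thesis
      by (auto simp: linked_def image_subset_iff case_prod_beta)
  qed
  show ?thesis
  proof (rule set_eqI)
    fix \<omega> :: "girg_outcome \<times> nat set"
    obtain w x U where \<omega>: "\<omega> = ((w, x), U)" by (metis prod.collapse)
    show "\<omega> \<in> E \<longleftrightarrow> \<omega> \<in> {\<omega> \<in> space M. linked (fst (fst \<omega>)) (snd (fst \<omega>)) (snd \<omega>)}"
      unfolding contains_event_def space_M \<omega> using key[of U w x] by auto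
  qed
qed

lemma measurable_linked: "Measurable.pred M (\<lambda>\<omega>. linked (fst (fst \<omega>)) (snd (fst \<omega>)) (snd \<omega>))"
proof (rule measurable_from_M[of "\<lambda>g U. linked (fst g) (snd g) U"])
  fix U assume U: "U \<in> ksets"
  show "Measurable.pred (W \<Otimes>\<^sub>M X) (\<lambda>g. linked (fst g) (snd g) U)"
    unfolding linked_def
  proof (rule pred_intros_finite(3)[OF finite_A])
    fix p assume "p \<in> A"
    then have mem: "lab U (fst p) \<in> {1..n}" "lab U (snd p) \<in> {1..n}"
      using A label_pairs_mem lab_mem[OF U] by blast+
    have [measurable]: "(\<lambda>g. fst g (lab U (fst p))) \<in> borel_measurable (W \<Otimes>\<^sub>M X)"
      "(\<lambda>g. fst g (lab U (snd p))) \<in> borel_measurable (W \<Otimes>\<^sub>M X)"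
      by (rule measurable_compose[OF measurable_fst measurable_weight_component], rule mem)+
    show "Measurable.pred (W \<Otimes>\<^sub>M X) (\<lambda>g. torus_dist d (snd g (lab U (fst p))) (snd g (lab U (snd p)))
      \<le> conn_threshold lam n d (fst g (lab U (fst p))) (fst g (lab U (snd p))))"
      using mem by (rule measurable_torus_dist_le) (unfold conn_threshold_def Let_def, measurable)
  qed
qed

lemma measure_linked:
  assumes U: "U \<in> ksets" and w: "\<And>v. v \<in> {1..n} \<Longrightarrow> 0 < w v"
  shows "measure X {x \<in> space X. linked w x U} = kappa_prob (kappas w U)"
proof -
  let ?X = "PiM {1..k} (\<lambda>_. torus_dist_measure d)"
  let ?r = "\<lambda>p. (kappas w U p / real n) powr (1 / real d) / 2"
  let ?S = "{x \<in> space ?X. \<forall>p\<in>A. torus_dist d (x (fst p)) (x (snd p)) \<le> ?r p}"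
  have distr: "distr X ?X (\<lambda>x. \<lambda>i\<in>{1..k}. x (lab U i)) = ?X"
    by (rule distr_PiM_reindex[OF prob_space_torus bij_betw_imp_inj_on[OF lab_bij[OF U]]])
      (use lab_mem[OF U] in blast)
  have meas: "(\<lambda>x. \<lambda>i\<in>{1..k}. x (lab U i)) \<in> X \<rightarrow>\<^sub>M ?X"
    using lab_mem[OF U] by (intro measurable_restrict measurable_component_singleton) blast
  have S: "?S \<in> sets ?X"
  proof (rule sets.sets_Collect_finite_All[OF _ finite_A])
    fix p assume "p \<in> A"
    then have "fst p \<in> {1..k}" "snd p \<in> {1..k}" using A label_pairs_mem by blast+
    then have "Measurable.pred ?X (\<lambda>x. torus_dist d (x (fst p)) (x (snd p)) \<le> ?r p)"
      by (rule measurable_torus_dist_le) auto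
    then show "{x \<in> space ?X. torus_dist d (x (fst p)) (x (snd p)) \<le> ?r p} \<in> sets ?X"
      by measurable
  qed
  have "torus_dist d (x (lab U (fst p))) (x (lab U (snd p))) \<le> ?r p \<longleftrightarrow>
      torus_dist d (x (lab U (fst p))) (x (lab U (snd p)))
      \<le> conn_threshold lam n d (w (lab U (fst p))) (w (lab U (snd p)))" if "p \<in> A" for p x
  proof -
    have p: "p \<in> label_pairs k" using that A by blast
    then have "0 < w (lab U (fst p))" "0 < w (lab U (snd p))"
      using label_pairs_mem lab_mem[OF U] w by blast+
    then show ?thesis
      using p lam n k d 
      by (subst le_conn_threshold_iff[OF lam _ _ _ d torus_dist_le_half[OF d]]) (auto simp: kappas_def)
  qed
  moreover have "fst p \<in> {1..k}" "snd p \<in> {1..k}" if "p \<in> A" for p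
    using that A label_pairs_mem by blast+
  ultimately have "{x \<in> space X. linked w x U} = (\<lambda>x. \<lambda>i\<in>{1..k}. x (lab U i)) -` ?S \<inter> space X"
    using measurable_space[OF meas] by (auto simp: linked_def simp del: One_nat_def atLeastAtMost_iff)
  then have "measure X {x \<in> space X. linked w x U} = measure ?X ?S"
    using measure_distr[OF meas S] by (simp only: distr)
  then show ?thesis
    unfolding kappa_prob_def torus_prob_def .
qed

lemma AE_weights_gt: "AE w in W. \<forall>v\<in>{1..n}. w0 < w v"
  using AE_weight_dist_gt[OF w0 \<beta>] prob_space_weight
  by (intro AE_finite_allI AE_PiM_component) auto

lemma integral_M:
  fixes f :: "girg_outcome \<times> nat set \<Rightarrow> real"
  assumes "f \<in> borel_measurable M" "\<And>\<omega>. \<bar>f \<omega>\<bar> \<le> 1"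
  shows "(\<integral>\<omega>. f \<omega> \<partial>M) = (\<integral>U. \<integral>w. \<integral>x. f ((w, x), U) \<partial>X \<partial>W \<partial>V)"
proof -
  have "integrable M f"
    using assms by (intro M.integrable_const_bound[where B=1]) auto
  then have "(\<integral>\<omega>. f \<omega> \<partial>M) = (\<integral>U. \<integral>g. f (g, U) \<partial>(W \<Otimes>\<^sub>M X) \<partial>V)"
    unfolding M_eq by (subst WXV.integral_snd[of "\<lambda>g U. f (g, U)"]) auto
  also have "\<dots> = (\<integral>U. \<integral>w. \<integral>x. f ((w, x), U) \<partial>X \<partial>W \<partial>V)"
  proof (rule Bochner_Integration.integral_cong[OF refl])
    fix U assume U: "U \<in> space V"
    have "(\<lambda>g. f (g, U)) \<in> borel_measurable (W \<Otimes>\<^sub>M X)"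
      using assms(1) U unfolding M_eq by measurable
    then have "integrable (W \<Otimes>\<^sub>M X) (\<lambda>g. f (g, U))"
      using assms(2) by (intro WX.P.integrable_const_bound[where B=1]) auto
    then show "(\<integral>g. f (g, U) \<partial>(W \<Otimes>\<^sub>M X)) = (\<integral>w. \<integral>x. f ((w, x), U) \<partial>X \<partial>W)"
      by (subst WX.integral_fst'[symmetric]) auto
  qed
  finally show ?thesis .
qed

lemma contains_cond_prob_eq:
  "AE \<omega> in M. contains_cond_prob n \<beta> w0 d k lam lab A \<omega> = kappa_prob (kappas (fst (fst \<omega>)) (snd \<omega>))"
  unfolding contains_cond_prob_def
proof (rule F.real_cond_exp_charact)
  note [measurable] = measurable_linked measurable_kappas_M
  have E[measurable]: "E \<in> sets M" unfolding E_eq by measurable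
  show "integrable M (indicator E :: _ \<Rightarrow> real)" by (simp add: less_top[symmetric])
  show "(\<lambda>\<omega>. kappa_prob (kappas (fst (fst \<omega>)) (snd \<omega>))) \<in> borel_measurable F"
    by (rule measurable_compose[OF measurable_kappas_F measurable_kappa_prob])
  show "integrable M (\<lambda>\<omega>. kappa_prob (kappas (fst (fst \<omega>)) (snd \<omega>)))"
    by (intro M.integrable_const_bound[where B=1]) (auto simp: kappa_prob_bounded)
  fix B assume "B \<in> sets F"
  then obtain S where S[measurable]: "S \<in> sets (PiM (label_pairs k) (\<lambda>_. borel))"
    and B: "B = (\<lambda>\<omega>. kappas (fst (fst \<omega>)) (snd \<omega>)) -` S \<inter> space M"
    unfolding kappa_algebra_def kappas_eq using measurable_space[OF measurable_kappas_M]
    by (subst (asm) sets_vimage_algebra2) auto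
  have "(\<integral>\<omega>\<in>B. indicat_real E \<omega> \<partial>M)
      = (\<integral>\<omega>. indicator S (kappas (fst (fst \<omega>)) (snd \<omega>)) *
          indicator {\<omega>. linked (fst (fst \<omega>)) (snd (fst \<omega>)) (snd \<omega>)} \<omega> \<partial>M)"
    unfolding set_lebesgue_integral_def B E_eq
    by (intro Bochner_Integration.integral_cong) (auto split: split_indicator)
  also have "\<dots> = (\<integral>U. \<integral>w. \<integral>x. indicator S (kappas w U) * indicator {x. linked w x U} x \<partial>X \<partial>W \<partial>V)"
    by (subst integral_M) (auto simp: indicator_def)
  also have "\<dots> = (\<integral>U. \<integral>w. \<integral>x. indicator S (kappas w U) * kappa_prob (kappas w U) \<partial>X \<partial>W \<partial>V)"
  proof (rule Bochner_Integration.integral_cong[OF refl])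
    fix U assume "U \<in> space V"
    then have U: "U \<in> ksets" by (simp add: space_uniform_count_measure)
    have [measurable]: "(\<lambda>w. kappas w U) \<in> W \<rightarrow>\<^sub>M PiM (label_pairs k) (\<lambda>_. borel)"
      using U by (rule measurable_kappas)
    have [measurable]: "Measurable.pred (W \<Otimes>\<^sub>M X) (\<lambda>g. linked (fst g) (snd g) U)"
      using measurable_compose[OF measurable_Pair2'[of U V] measurable_linked[unfolded M_eq]] \<open>U \<in> space V\<close>
      by simp
    show "(\<integral>w. \<integral>x. indicator S (kappas w U) * indicator {x. linked w x U} x \<partial>X \<partial>W)
      = (\<integral>w. \<integral>x. indicator S (kappas w U) * kappa_prob (kappas w U) \<partial>X \<partial>W)"
    proof (rule integral_cong_AE)
      have "(\<lambda>w. \<integral>x. indicator S (kappas w U) * (if linked w x U then 1 else 0 :: real) \<partial>X)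
          \<in> borel_measurable W"
        by (rule X.borel_measurable_lebesgue_integral) (unfold case_prod_beta, measurable)
      then show "(\<lambda>w. \<integral>x. indicator S (kappas w U) * indicat_real {x. linked w x U} x \<partial>X) \<in> borel_measurable W"
        by (simp add: indicator_def of_bool_def)
      show "AE w in W. (\<integral>x. indicator S (kappas w U) * indicator {x. linked w x U} x \<partial>X)
          = (\<integral>x. indicator S (kappas w U) * kappa_prob (kappas w U) \<partial>X)"
        using AE_weights_gt
      proof eventually_elim
        case (elim w)
        then have "measure X {x \<in> space X. linked w x U} = kappa_prob (kappas w U)"
          using w0 by (intro measure_linked[OF U]) fastforce
        then show ?case
          by (simp add: X.prob_space Int_def conj_commute del: One_nat_def)
      qed
    qed measurable
  qed
  also have "\<dots> = (\<integral>\<omega>. indicator S (kappas (fst (fst \<omega>)) (snd \<omega>)) * kappa_prob (kappas (fst (fst \<omega>)) (snd \<omega>)) \<partial>M)"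
    by (subst integral_M) (auto simp: indicator_def kappa_prob_bounded)
  also have "\<dots> = (\<integral>\<omega>\<in>B. kappa_prob (kappas (fst (fst \<omega>)) (snd \<omega>)) \<partial>M)"
    unfolding set_lebesgue_integral_def B
    by (intro Bochner_Integration.integral_cong) (auto split: split_indicator)
  finally show "(\<integral>\<omega>\<in>B. indicat_real E \<omega> \<partial>M) = (\<integral>\<omega>\<in>B. kappa_prob (kappas (fst (fst \<omega>)) (snd \<omega>)) \<partial>M)" .
qed

lemma kappa_prob_bounds:
  fixes \<kappa> :: "nat \<times> nat \<Rightarrow> real"
  assumes c: "0 < c" and \<kappa>: "\<And>p. p \<in> A \<Longrightarrow> c \<le> \<kappa> p \<and> \<kappa> p \<le> real n"
    and small: "real (card A) * ln (real n / c) / real d \<le> 1 / 2"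
    and \<delta>: "2 * (real (card A) * ln (real n / c) / real d) \<le> \<delta>"
  shows "(\<Prod>p\<in>A. (\<kappa> p / real n) powr (1 + \<delta>)) \<le> kappa_prob \<kappa>"
    and "kappa_prob \<kappa> \<le> (\<Prod>p\<in>A. (\<kappa> p / real n) powr (1 - \<delta>))"
proof -
  have n0: "0 < real n" and d0: "0 < real d" using n k d by auto
  define y where "y p = ln (real n / \<kappa> p) / real d" for p
  define Y where "Y = (\<Sum>p\<in>A. y p)"
  have \<kappa>0: "0 < \<kappa> p" if "p \<in> A" for p using \<kappa>[OF that] c by linarith
  have y0: "0 \<le> y p" if "p \<in> A" for p
    using \<kappa>[OF that] \<kappa>0[OF that] d0 n0 by (simp add: y_def)
  have y_le: "y p \<le> ln (real n / c) / real d" if "p \<in> A" for p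
    unfolding y_def using \<kappa>[OF that] \<kappa>0[OF that] c d0 n0
    by (intro divide_right_mono ln_mono) (auto simp: frac_le)
  have "Y \<le> real (card A) * ln (real n / c) / real d"
    unfolding Y_def times_divide_eq_right[symmetric] by (rule sum_bounded_above) (rule y_le)
  then have Y_le: "Y \<le> 1 / 2" "2 * Y \<le> \<delta>" using small \<delta> by linarith+
  have root: "(\<kappa> p / real n) powr (1 / real d) = exp (- y p)" if "p \<in> A" for p
    using \<kappa>0[OF that] n0 by (simp add: powr_def y_def ln_div minus_divide_left)
  define r where "r p = 2 * ((\<kappa> p / real n) powr (1 / real d) / 2)" for p
  have r: "r p = exp (- y p)" if "p \<in> A" for p
    using root[OF that] by (simp add: r_def)
  define P where "P = circle_prob {1..k} A r"
  have P: "kappa_prob \<kappa> = P ^ d"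
    unfolding kappa_prob_def P_def r_def using k d A label_pairs_mem
    by (intro torus_prob_eq_circle_prob) (force simp del: One_nat_def)+
  have S: "(\<Sum>p\<in>A. 1 - r p) = (\<Sum>p\<in>A. 1 - exp (- y p))" by (simp add: r)
  have circle: "1 - (\<Sum>p\<in>A. 1 - r p) \<le> P" "P \<le> 1 - (\<Sum>p\<in>A. 1 - r p) + (\<Sum>p\<in>A. 1 - r p)\<^sup>2 / 2"
    unfolding P_def using A y0 r
    by (intro circle_prob_bounds; fastforce simp: label_pairs_def)+
  have lower: "exp (- (1 + \<delta>) * Y) \<le> P" and upper: "P \<le> exp (- (1 - \<delta>) * Y)"
    using exp_bounds_of_bonferroni[OF finite_A y0 Y_def Y_le S circle] by simp_all
  have prod: "(\<Prod>p\<in>A. (\<kappa> p / real n) powr s) = exp (- s * Y) ^ d" for s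
  proof -
    have "(\<Prod>p\<in>A. (\<kappa> p / real n) powr s) = (\<Prod>p\<in>A. exp (real d * (- s * y p)))"
    proof (intro prod.cong refl)
      fix p assume "p \<in> A"
      from \<kappa>0[OF this] show "(\<kappa> p / real n) powr s = exp (real d * (- s * y p))"
        using n0 d0 by (simp add: powr_def y_def ln_div field_simps)
    qed
    also have "\<dots> = exp (real d * (- s * Y))"
      by (simp add: exp_sum[OF finite_A, symmetric] Y_def sum_distrib_left)
    finally show ?thesis by (simp only: exp_of_nat_mult)
  qed
  show "(\<Prod>p\<in>A. (\<kappa> p / real n) powr (1 + \<delta>)) \<le> kappa_prob \<kappa>"
    unfolding prod P by (intro power_mono lower) simp
  have "0 \<le> P" by (simp add: P_def circle_prob_def)
  then show "kappa_prob \<kappa> \<le> (\<Prod>p\<in>A. (\<kappa> p / real n) powr (1 - \<delta>))"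
    unfolding prod P by (intro power_mono upper)
qed

lemma AE_M_weights_gt: "AE \<omega> in M. \<forall>v\<in>{1..n}. w0 < fst (fst \<omega>) v"
proof -
  have "AE g in W \<Otimes>\<^sub>M X. \<forall>v\<in>{1..n}. w0 < fst g v"
    using AE_weights_gt by (intro AE_distrD[OF measurable_fst]) (simp only: X.distr_pair_fst)
  then show ?thesis
    unfolding M_eq by (intro AE_distrD[OF measurable_fst]) (simp only: V.distr_pair_fst)
qed

lemma AE_kappa_bounds:
  assumes "lam * w0\<^sup>2 \<le> real n"
  shows "AE \<omega> in M. \<forall>p\<in>A. lam * w0\<^sup>2 \<le> kappa lam n lab p \<omega> \<and> kappa lam n lab p \<omega> \<le> real n"
  using AE_M_weights_gt AE_space
proof eventually_elim
  case (elim \<omega>)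
  obtain w x U where \<omega>: "\<omega> = ((w, x), U)" by (metis prod.collapse)
  show ?case
  proof
    fix p assume "p \<in> A"
    then have "fst p \<in> {1..k}" "snd p \<in> {1..k}" using A label_pairs_mem by blast+
    then have "w0 < w (lab U (fst p))" "w0 < w (lab U (snd p))"
      using elim lab_mem[of U] unfolding \<omega> space_M by auto
    then have "w0 * w0 \<le> w (lab U (fst p)) * w (lab U (snd p))"
      using w0 by (intro mult_mono) auto
    then show "lam * w0\<^sup>2 \<le> kappa lam n lab p \<omega> \<and> kappa lam n lab p \<omega> \<le> real n"
      using lam assms by (cases p) (auto simp: \<omega> kappa_def power2_eq_square mult.assoc)
  qed
qed

lemma AE_contains_cond_prob_bounds:
  assumes "lam * w0\<^sup>2 \<le> real n"
    and "real (card A) * ln (real n / (lam * w0\<^sup>2)) / real d \<le> 1 / 2"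
    and "2 * (real (card A) * ln (real n / (lam * w0\<^sup>2)) / real d) \<le> \<delta>"
  shows "AE \<omega> in M.
    (\<Prod>p\<in>A. (kappa lam n lab p \<omega> / real n) powr (1 + \<delta>)) \<le> contains_cond_prob n \<beta> w0 d k lam lab A \<omega> \<and>
    contains_cond_prob n \<beta> w0 d k lam lab A \<omega> \<le> (\<Prod>p\<in>A. (kappa lam n lab p \<omega> / real n) powr (1 - \<delta>))"
  using AE_kappa_bounds[OF assms(1)] contains_cond_prob_eq
proof eventually_elim
  case (elim \<omega>)
  define \<kappa> where "\<kappa> = kappas (fst (fst \<omega>)) (snd \<omega>)"
  have eq: "kappa lam n lab p \<omega> = \<kappa> p" if "p \<in> A" for p
    using that A unfolding \<kappa>_def kappas_eq[symmetric] by auto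
  have "0 < lam * w0\<^sup>2" using lam w0 by simp
  from kappa_prob_bounds[OF this _ assms(2,3), of \<kappa>] elim
  show ?case by (simp add: eq \<kappa>_def[symmetric])
qed

end

section \<open>Asymptotics\<close>

lemma abs_ratio_minus_one_le:
  fixes q :: "'a \<Rightarrow> real"
  assumes q: "\<And>p. p \<in> A \<Longrightarrow> 0 < q p \<and> - ln (q p) \<le> L" and "finite A" "0 \<le> \<delta>"
    and h: "(\<Prod>p\<in>A. q p powr (1 + \<delta>)) \<le> h" "h \<le> (\<Prod>p\<in>A. q p powr (1 - \<delta>))"
    and u: "\<delta> * (real (card A) * L) \<le> u"
  shows "\<bar>h / (\<Prod>p\<in>A. q p) - 1\<bar> \<le> exp u - 1"
proof -
  define T where "T = (\<Sum>p\<in>A. - ln (q p))"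
  have prod: "(\<Prod>p\<in>A. q p powr s) = exp (- s * T)" for s
  proof -
    have "(\<Prod>p\<in>A. q p powr s) = (\<Prod>p\<in>A. exp (- s * - ln (q p)))"
      using q by (intro prod.cong) (force simp: powr_def)+
    then show ?thesis
      by (simp only: exp_sum[OF \<open>finite A\<close>, symmetric] T_def sum_distrib_left)
  qed
  have prod1: "(\<Prod>p\<in>A. q p) = exp (- T)"
  proof -
    have "(\<Prod>p\<in>A. q p) = (\<Prod>p\<in>A. q p powr 1)" using q by (intro prod.cong) force+
    then show ?thesis by (simp only: prod mult_minus_left mult_1)
  qed
  have "T \<le> real (card A) * L"
    unfolding T_def using q by (intro sum_bounded_above) auto
  then have "\<delta> * T \<le> u" using \<open>0 \<le> \<delta>\<close> u mult_left_mono[of T "real (card A) * L" \<delta>] by linarith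
  have "exp (- u) \<le> exp (- (1 + \<delta>) * T) / exp (- T)"
    using \<open>\<delta> * T \<le> u\<close> by (simp add: exp_diff[symmetric] algebra_simps)
  also have "\<dots> \<le> h / exp (- T)"
    using h(1) by (intro divide_right_mono) (auto simp: prod)
  finally have lower: "exp (- u) \<le> h / exp (- T)" .
  have "h / exp (- T) \<le> exp (- (1 - \<delta>) * T) / exp (- T)"
    using h(2) by (intro divide_right_mono) (auto simp: prod)
  also have "\<dots> \<le> exp u"
    using \<open>\<delta> * T \<le> u\<close> by (simp add: exp_diff[symmetric] algebra_simps)
  finally have "h / exp (- T) \<le> exp u" .
  then show ?thesis
    using lower exp_ge_add_one_self[of u] exp_ge_add_one_self[of "- u"]
    unfolding prod1 by linarith
qed

lemma eventually_contains_cond_prob_bounds: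
  fixes d :: "nat \<Rightarrow> nat"
  assumes "lam > 0" "w0 > 0" "\<beta> > 1" "k \<ge> 1" "labelling k lab" "A \<subseteq> label_pairs k"
    and d: "(\<lambda>n. real (d n)) \<in> \<omega>(\<lambda>n. ln (real n))"
  defines "C \<equiv> 4 * real (card A) + 1"
  shows "\<forall>\<^sub>F n in sequentially. 0 < lam * w0\<^sup>2 \<and> lam * w0\<^sup>2 \<le> real n \<and> ln (real n / (lam * w0\<^sup>2)) \<le> 2 * ln (real n) \<and>
    (AE \<omega> in sampled_girg n \<beta> w0 (d n) k.
      (\<forall>p\<in>A. lam * w0\<^sup>2 \<le> kappa lam n lab p \<omega> \<and> kappa lam n lab p \<omega> \<le> real n) \<and>
      (\<Prod>p\<in>A. (kappa lam n lab p \<omega> / real n) powr (1 + C * ln (real n) / real (d n)))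
        \<le> contains_cond_prob n \<beta> w0 (d n) k lam lab A \<omega> \<and>
      contains_cond_prob n \<beta> w0 (d n) k lam lab A \<omega>
        \<le> (\<Prod>p\<in>A. (kappa lam n lab p \<omega> / real n) powr (1 - C * ln (real n) / real (d n))))"
proof -
  let ?c = "lam * w0\<^sup>2"
  have c: "0 < ?c" using assms by simp
  have "(\<lambda>n. ln (real n)) \<in> o(\<lambda>n. real (d n))"
    using d by (simp add: smallomega_iff_smallo)
  then have ev: "\<forall>\<^sub>F n in sequentially. norm (ln (real n)) \<le> 1 / (2 * C) * norm (real (d n))"
    by (rule landau_o.smallD) (simp add: C_def add_pos_nonneg)
  have nat: "\<forall>\<^sub>F n in sequentially. x \<le> real n" for x
    by (rule eventually_sequentiallyI[of "nat \<lceil>x\<rceil>"]) linarith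
  show ?thesis
    using ev nat[of ?c] nat[of "1 / ?c"] eventually_ge_at_top[of k] eventually_ge_at_top[of 2]
  proof eventually_elim
    case (elim n)
    have ln0: "0 < ln (real n)" using elim by simp
    have C0: "0 < C" by (simp add: C_def add_pos_nonneg)
    have "0 < d n"
    proof (rule ccontr)
      assume "\<not> 0 < d n"
      then show False using elim(1) ln0 by simp
    qed
    have small: "C * ln (real n) / real (d n) \<le> 1 / 2"
      using elim(1) ln0 C0 \<open>0 < d n\<close> by (simp add: field_simps)
    have "ln (1 / ?c) \<le> ln (real n)"
      using elim c by (intro ln_mono) auto
    then have L: "ln (real n / ?c) \<le> 2 * ln (real n)"
      using c elim assms by (simp add: ln_div)
    have "real (card A) * ln (real n / ?c) \<le> real (card A) * (2 * ln (real n))"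
      using L by (intro mult_left_mono) auto
    then have "2 * (real (card A) * ln (real n / ?c)) \<le> C * ln (real n)"
      using ln0 by (simp add: C_def algebra_simps)
    then have \<delta>: "2 * (real (card A) * ln (real n / ?c) / real (d n)) \<le> C * ln (real n) / real (d n)"
      using \<open>0 < d n\<close> by (simp add: divide_right_mono)
    interpret sampled_girg_setup lam w0 \<beta> k n "d n" lab A
      using assms elim \<open>0 < d n\<close> by unfold_locales auto
    have "real (card A) * ln (real n / ?c) / real (d n) \<le> 1 / 2"
      using \<delta> small by linarith
    from AE_contains_cond_prob_bounds[OF elim(2) this \<delta>] AE_kappa_bounds[OF elim(2)]
    show ?case using c elim(2) L by auto
  qed
qed

theorem theorem2:
  fixes lam w0 \<beta> :: real and k :: nat and d :: "nat \<Rightarrow> nat"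
    and lab :: "nat set \<Rightarrow> nat \<Rightarrow> nat"
  assumes "lam > 0" and "w0 > 0" and "\<beta> > 2" and "k \<ge> 3" and "labelling k lab"
  shows
    "((\<lambda>n. real (d n)) \<in> \<omega>(\<lambda>n. (ln (real n))\<^sup>2) \<longrightarrow>
       (\<forall>A \<subseteq> label_pairs k. \<exists>\<epsilon> :: nat \<Rightarrow> real. \<epsilon> \<longlonglongrightarrow> 0 \<and>
         (\<forall>\<^sub>F n in sequentially. AE \<omega> in sampled_girg n \<beta> w0 (d n) k.
            \<bar>contains_cond_prob n \<beta> w0 (d n) k lam lab A \<omega>
               / (\<Prod>p\<in>A. kappa lam n lab p \<omega> / real n) - 1\<bar> \<le> \<epsilon> n)))
     \<and>
     ((\<lambda>n. real (d n)) \<in> \<omega>(\<lambda>n. ln (real n)) \<longrightarrow>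
       (\<forall>A \<subseteq> label_pairs k. \<exists>C > 0. \<exists>\<epsilon> :: nat \<Rightarrow> real. \<epsilon> \<longlonglongrightarrow> 0 \<and>
         (\<forall>\<^sub>F n in sequentially. AE \<omega> in sampled_girg n \<beta> w0 (d n) k.
            (1 - \<epsilon> n) * (\<Prod>p\<in>A. (kappa lam n lab p \<omega> / real n) powr (1 + C * ln (real n) / real (d n)))
              \<le> contains_cond_prob n \<beta> w0 (d n) k lam lab A \<omega> \<and>
            contains_cond_prob n \<beta> w0 (d n) k lam lab A \<omega>
              \<le> (1 + \<epsilon> n) * (\<Prod>p\<in>A. (kappa lam n lab p \<omega> / real n) powr (1 - C * ln (real n) / real (d n))))))"
proof (intro conjI impI allI)
  fix A assume d: "(\<lambda>n. real (d n)) \<in> \<omega>(\<lambda>n. (ln (real n))\<^sup>2)" and A: "A \<subseteq> label_pairs k"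
  let ?m = "real (card A)"
  define C where "C = 4 * ?m + 1"
  define u where "u n = C * (?m * 2) * ((ln (real n))\<^sup>2 / real (d n))" for n
  have fin: "finite A"
    using A by (rule finite_subset[OF _ finite_subset[of _ "{1..k} \<times> {1..k}"]]) (auto simp: label_pairs_def)
  have "(\<lambda>n. ln (real n)) \<in> O(\<lambda>n. (ln (real n))\<^sup>2)"
  proof (rule landau_o.big_mono)
    show "\<forall>\<^sub>F n in sequentially. norm (ln (real n)) \<le> norm ((ln (real n))\<^sup>2)"
      using eventually_ge_at_top[of 3]
    proof eventually_elim
      case (elim n)
      have "1 \<le> ln (real n)"
        using elim exp_le by (subst ln_ge_iff) auto
      then show ?case using self_le_power[of "ln (real n)" 2] by simp
    qed
  qed
  then have "(\<lambda>n. real (d n)) \<in> \<omega>(\<lambda>n. ln (real n))"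
    using d landau_o.big_small_trans unfolding smallomega_iff_smallo by blast
  then have bounds: "\<forall>\<^sub>F n in sequentially. 0 < lam * w0\<^sup>2 \<and> lam * w0\<^sup>2 \<le> real n \<and> ln (real n / (lam * w0\<^sup>2)) \<le> 2 * ln (real n) \<and>
    (AE \<omega> in sampled_girg n \<beta> w0 (d n) k.
      (\<forall>p\<in>A. lam * w0\<^sup>2 \<le> kappa lam n lab p \<omega> \<and> kappa lam n lab p \<omega> \<le> real n) \<and>
      (\<Prod>p\<in>A. (kappa lam n lab p \<omega> / real n) powr (1 + C * ln (real n) / real (d n)))
        \<le> contains_cond_prob n \<beta> w0 (d n) k lam lab A \<omega> \<and>
      contains_cond_prob n \<beta> w0 (d n) k lam lab A \<omega>
        \<le> (\<Prod>p\<in>A. (kappa lam n lab p \<omega> / real n) powr (1 - C * ln (real n) / real (d n))))"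
    unfolding C_def using assms A by (intro eventually_contains_cond_prob_bounds) auto
  have "(\<lambda>n. (ln (real n))\<^sup>2 / real (d n)) \<longlonglongrightarrow> 0"
    using d unfolding smallomega_iff_smallo by (rule smalloD_tendsto)
  then have "u \<longlonglongrightarrow> C * (?m * 2) * 0"
    unfolding u_def by (intro tendsto_mult_left)
  then have "(\<lambda>n. exp (u n) - 1) \<longlonglongrightarrow> exp 0 - 1"
    by (intro tendsto_diff tendsto_exp tendsto_const) simp
  moreover have "\<forall>\<^sub>F n in sequentially. AE \<omega> in sampled_girg n \<beta> w0 (d n) k.
      \<bar>contains_cond_prob n \<beta> w0 (d n) k lam lab A \<omega> / (\<Prod>p\<in>A. kappa lam n lab p \<omega> / real n) - 1\<bar> \<le> exp (u n) - 1"
    using bounds eventually_ge_at_top[of 1]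
  proof eventually_elim
    case (elim n)
    let ?c = "lam * w0\<^sup>2" and ?L = "2 * ln (real n)"
    have n: "0 < real n" "0 \<le> ln (real n)" and c: "0 < ?c" using elim by auto
    have "ln (real n / ?c) = ln (real n) - ln ?c" using n assms(1,2) by (simp add: ln_div)
    moreover have "ln (real n / ?c) \<le> ?L" using elim by blast
    ultimately have L: "ln (real n) - ln ?c \<le> ?L" by simp
    have "AE \<omega> in sampled_girg n \<beta> w0 (d n) k.
      (\<forall>p\<in>A. ?c \<le> kappa lam n lab p \<omega> \<and> kappa lam n lab p \<omega> \<le> real n) \<and>
      (\<Prod>p\<in>A. (kappa lam n lab p \<omega> / real n) powr (1 + C * ln (real n) / real (d n)))
        \<le> contains_cond_prob n \<beta> w0 (d n) k lam lab A \<omega> \<and>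
      contains_cond_prob n \<beta> w0 (d n) k lam lab A \<omega>
        \<le> (\<Prod>p\<in>A. (kappa lam n lab p \<omega> / real n) powr (1 - C * ln (real n) / real (d n)))"
      using elim by blast
    then show ?case
    proof eventually_elim
      case (elim \<omega>)
      show ?case
      proof (rule abs_ratio_minus_one_le[where \<delta>="C * ln (real n) / real (d n)" and L="?L"])
        fix p assume "p \<in> A"
        then have k: "?c \<le> kappa lam n lab p \<omega>" using elim by blast
        have k0: "0 < kappa lam n lab p \<omega>" using k c by linarith
        have "ln ?c \<le> ln (kappa lam n lab p \<omega>)" using k c by (intro ln_mono) auto
        moreover have "ln (kappa lam n lab p \<omega> / real n) = ln (kappa lam n lab p \<omega>) - ln (real n)"
          using k0 n by (simp add: ln_div)
        ultimately have "- ln (kappa lam n lab p \<omega> / real n) \<le> ?L" using L by linarith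
        then show "0 < kappa lam n lab p \<omega> / real n \<and> - ln (kappa lam n lab p \<omega> / real n) \<le> ?L"
          using k0 n by simp
      next
        show "C * ln (real n) / real (d n) * (?m * ?L) \<le> u n"
          by (simp add: u_def power2_eq_square mult_ac)
      qed (use elim fin n in \<open>auto simp: C_def\<close>)
    qed
  qed
  ultimately show "\<exists>\<epsilon> :: nat \<Rightarrow> real. \<epsilon> \<longlonglongrightarrow> 0 \<and> (\<forall>\<^sub>F n in sequentially. AE \<omega> in sampled_girg n \<beta> w0 (d n) k.
      \<bar>contains_cond_prob n \<beta> w0 (d n) k lam lab A \<omega> / (\<Prod>p\<in>A. kappa lam n lab p \<omega> / real n) - 1\<bar> \<le> \<epsilon> n)"
    by (intro exI[of _ "\<lambda>n. exp (u n) - 1"]) simp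
next
  fix A assume d: "(\<lambda>n. real (d n)) \<in> \<omega>(\<lambda>n. ln (real n))" and A: "A \<subseteq> label_pairs k"
  have "\<forall>\<^sub>F n in sequentially. AE \<omega> in sampled_girg n \<beta> w0 (d n) k.
      (1 - 0) * (\<Prod>p\<in>A. (kappa lam n lab p \<omega> / real n) powr (1 + (4 * real (card A) + 1) * ln (real n) / real (d n)))
        \<le> contains_cond_prob n \<beta> w0 (d n) k lam lab A \<omega> \<and>
      contains_cond_prob n \<beta> w0 (d n) k lam lab A \<omega>
        \<le> (1 + 0) * (\<Prod>p\<in>A. (kappa lam n lab p \<omega> / real n) powr (1 - (4 * real (card A) + 1) * ln (real n) / real (d n)))"
  proof -
    have "\<beta> > 1" "k \<ge> 1" using assms by auto
    from eventually_contains_cond_prob_bounds[OF assms(1,2) this assms(5) A d]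
    show ?thesis by (rule eventually_mono) auto
  qed
  then show "\<exists>C > 0. \<exists>\<epsilon> :: nat \<Rightarrow> real. \<epsilon> \<longlonglongrightarrow> 0 \<and>
         (\<forall>\<^sub>F n in sequentially. AE \<omega> in sampled_girg n \<beta> w0 (d n) k.
            (1 - \<epsilon> n) * (\<Prod>p\<in>A. (kappa lam n lab p \<omega> / real n) powr (1 + C * ln (real n) / real (d n)))
              \<le> contains_cond_prob n \<beta> w0 (d n) k lam lab A \<omega> \<and>
            contains_cond_prob n \<beta> w0 (d n) k lam lab A \<omega>
              \<le> (1 + \<epsilon> n) * (\<Prod>p\<in>A. (kappa lam n lab p \<omega> / real n) powr (1 - C * ln (real n) / real (d n))))"
    by (intro exI[of _ "4 * real (card A) + 1"] conjI exI[of _ "\<lambda>_. 0 :: real"] tendsto_const)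
      (simp_all add: add_nonneg_pos)
qed

end
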